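(* Let $m,s\ge 0$ be integers and let $a$ be a real number with $a\notin\mathbb{Z}$. Then \begin{align*} \sum_{n=1}^\infty \frac{\zeta_n(2m+1)}{n^{2s}(n^2-a^2)} &=\frac12\sum_{n=1}^\infty\frac{1}{n^{2s+2m+1}(n^2-a^2)} +\sum_{n=1}^s\sum_{k=1}^n\binom{2m+2k-1}{2k-1}\frac{\zeta(2m+2k-1)\zeta(2n-2k+2)}{a^{2s-2n+2}}\\ &\quad+\zeta(2m+1)\left(\sum_{n=1}^\infty\frac{1}{n^2-a^2}\left(\frac{1}{n^{2s}}-\frac{1}{a^{2s}}\right)\right) -\frac12\sum_{k=2}^{s+1}\binom{2m+2k-2}{2k-2}\frac{\zeta(2m+2k-1)}{a^{2s-2k+4}}\\ &\quad+\frac{\pi\cot(\pi a)}{4a^{2s+1}}\sum_{n=1}^\infty\left\{\frac{1}{(n-a)^{2m+1}}+\frac{1}{(n+a)^{2m+1}}-\frac{2}{n^{2m+1}}\right\} -\frac12\sum_{j=1}^s\frac{\zeta(2m+2j+1)}{a^{2s+2-2j}}\binom{2m+2j}{2j-1}\\ &\quad+\sum_{k=1}^m\sum_{j=1}^s\frac{\zeta(2k)}{a^{2s+2-2j}}\binom{2m-2k+2j}{2j-1}\zeta(2m+2j-2k+1)\\ &\quad-\frac{1}{2a^{2s+1}}\sum_{k=0}^m\zeta(2k)\sum_{n=1}^\infty\left\{\frac{1}{(n-a)^{2m-2k+2}}-\frac{1}{(n+a)^{2m-2k+2}}\right\}, \end{align*} where the value $\zeta(0)=-\frac12$ is used and $\zeta(1)$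 is to be replaced by $0$ wherever it occurs.
   Context: $\zeta_n(k)=\sum_{j=1}^n j^{-k}$ is the generalized harmonic number and $\zeta(s)=\sum_{n\ge1}n^{-s}$ is the Riemann zeta function. Empty sums are zero.
   Formalization: In the second term (double sum over n and k) the printed binomial (2m+2k-1 choose 2k-1) is replaced by (2m+2k-2 choose 2k-2); the printed identity is false for all m,s ≥ 1 (for m=s=1 it is off by 2ζ(2)ζ(3)/a²), and the two forms agree when m=0 or s=0. *)

theory Defs
  imports "HOL-Analysis.Analysis"
begin

definition gen_harmonic :: "nat \<Rightarrow> nat \<Rightarrow> real" where
  "gen_harmonic n k = (\<Sum>j=1..n. 1 / real j ^ k)"

text \<open>
  The Riemann zeta function at natural numbers: the Dirichlet series for \<open>k \<ge> 2\<close> and the value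
  \<open>- 1 / 2\<close> of its analytic continuation at \<open>0\<close>. At the pole \<open>k = 1\<close> the value \<open>0\<close> is the
  replacement for \<open>\<zeta>(1)\<close> used in the formula below; it is not a property of \<open>\<zeta>\<close>.
\<close>

definition zeta :: "nat \<Rightarrow> real" where
  "zeta k = (if k = 0 then - 1 / 2
             else if k = 1 then 0
             else (\<Sum>n. 1 / real (Suc n) ^ k))"

text \<open>
  In the evaluation of \<open>\<Sum>\<^sub>n gen_harmonic n (2m+1) / (n^(2s) (n^2 - a^2))\<close> the source prints the binomial
  coefficient of \<open>\<zeta>(2m+2k-1) \<zeta>(2n-2k+2)\<close> as \<open>2m+2k-1\<close> over \<open>2k-1\<close>. That identity fails for all
  \<open>m, s \<ge> 1\<close> (for \<open>m = s = 1\<close> it contradicts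
  \<open>\<Sum>\<^sub>n gen_harmonic n 3 / n^2 = 3 \<zeta>(2) \<zeta>(3) - 9/2 \<zeta>(5)\<close>);
  the coefficient used here is \<open>2m+2k-2\<close> over \<open>2k-2\<close>. The two agree for \<open>m = 0\<close>.
\<close>

end

theory Submission
  imports Defs "HOL-Real_Asymp.Real_Asymp"
begin

text \<open>
  For \<open>s = 0\<close>, expand \<open>\<pi> cot (\<pi> a)\<close> as the limit of \<open>\<Sum>\<^bsub>\<bar>n\<bar> \<le> N\<^esub> 1 / (a - n)\<close> and multiply it with
  \<open>\<Sum>\<^sub>j (1 / (j - a)^p + 1 / (j + a)^p - 2 / j^p)\<close>, where \<open>p = 2m + 1\<close>. Decomposing every product
  \<open>1 / ((a - n) (j - a)^p)\<close> into partial fractions in \<open>a\<close>, the coefficient of \<open>1 / (a - n)\<close> sums over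
  \<open>j\<close> to a harmonic number of order \<open>p\<close>, and the coefficient of \<open>1 / (j - a)^i\<close> sums over \<open>n \<noteq> j\<close> to
  \<open>2 \<zeta>(p + 1 - i)\<close> or \<open>0\<close> according to parity; the diagonal \<open>n = j\<close> accounts for \<open>\<zeta>(0) = -1/2\<close>.

  Both sides of the case \<open>s = 0\<close> are power series in \<open>a\<close> near \<open>0\<close>, and their coefficients evaluate
  the Euler sums \<open>\<Sum>\<^sub>n H\<^sub>n / n^(2s)\<close>, \<open>H\<^sub>n\<close> of order \<open>p\<close>. The general case follows by induction on \<open>s\<close>, since
  \<open>1 / (n^(2s+2) (n^2 - a^2)) = (1 / (n^(2s) (n^2 - a^2)) - 1 / n^(2s+2)) / a^2\<close>.
\<close>

section \<open>The partial fractions of the cotangent\<close>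

lemma one_minus_notin_Ints: "(x::real) \<notin> \<int> \<Longrightarrow> 1 - x \<notin> \<int>"
  by (metis Ints_1 Ints_diff diff_add_cancel add_diff_cancel_left')

lemma Gamma_reflection_real:
  fixes x :: real
  shows "Gamma x * Gamma (1 - x) = pi / sin (pi * x)"
proof -
  have "complex_of_real (Gamma x * Gamma (1 - x)) = of_real (pi / sin (pi * x))"
    using Gamma_reflection_complex[of "of_real x"]
    by (metis (no_types) Gamma_complex_of_real of_real_1 of_real_diff of_real_divide of_real_mult
        sin_of_real)
  thus ?thesis by (simp only: of_real_eq_iff)
qed

lemma sin_pi_mult_nonzero: "x \<notin> \<int> \<Longrightarrow> sin (pi * x) \<noteq> (0::real)"
  by (auto simp: sin_zero_iff_int2 mult.commute)

text \<open>Logarithmic derivative of the reflection formula: near \<open>a\<close> the function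
  \<open>f\<close> is constantly \<open>pi\<close>, so its derivative vanishes, and the nonzero
  factor \<open>Gamma a * Gamma (1 - a)\<close> cancels.\<close>

lemma Digamma_reflection_real:
  fixes a :: real
  assumes "a \<notin> \<int>"
  shows "Digamma (1 - a) - Digamma a = pi * cot (pi * a)"
proof -
  have nz: "sin (pi * a) \<noteq> 0" using assms by (rule sin_pi_mult_nonzero)
  have a: "a \<notin> \<int>\<^sub>\<le>\<^sub>0" "1 - a \<notin> \<int>\<^sub>\<le>\<^sub>0"
    using assms one_minus_notin_Ints[OF assms] nonpos_Ints_Int by blast+
  define f where "f = (\<lambda>x::real. Gamma x * Gamma (1 - x) * sin (pi * x))"
  have "open (- \<int> :: real set)" by (simp add: open_Compl)
  hence "eventually (\<lambda>x. x \<in> - \<int>) (nhds a)"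
    using assms by (intro eventually_nhds_in_open) auto
  hence ev: "eventually (\<lambda>x. f x = pi) (nhds a)"
    by eventually_elim (simp add: f_def Gamma_reflection_real sin_pi_mult_nonzero)
  have "(f has_field_derivative
      (Gamma a * Gamma (1 - a)) * ((Digamma a - Digamma (1 - a)) * sin (pi * a) + pi * cos (pi * a))) (at a)"
    unfolding f_def by (rule derivative_eq_intros refl a | simp add: a algebra_simps)+
  moreover have "(f has_field_derivative 0) (at a)"
    using DERIV_cong_ev[OF refl ev refl] by simp
  ultimately have "(Gamma a * Gamma (1 - a)) *
      ((Digamma a - Digamma (1 - a)) * sin (pi * a) + pi * cos (pi * a)) = 0"
    by (rule DERIV_unique)
  hence "(Digamma a - Digamma (1 - a)) * sin (pi * a) + pi * cos (pi * a) = 0"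
    using a by (simp add: Gamma_eq_zero_iff)
  with nz show ?thesis by (simp add: cot_def field_simps)
qed

lemma sum_symmetric_int:
  fixes f :: "int \<Rightarrow> 'a::comm_monoid_add"
  shows "(\<Sum>n=-int N..int N. f n) = f 0 + (\<Sum>n<N. f (int (Suc n)) + f (- int (Suc n)))"
proof (induction N)
  case (Suc N)
  have "{-int (Suc N)..int (Suc N)} = insert (int (Suc N)) (insert (- int (Suc N)) {-int N..int N})"
    by auto
  thus ?case using Suc by (simp add: add_ac)
qed simp

text \<open>The limit formulas for \<open>Digamma\<close> at \<open>1 - a\<close> and at
  \<open>a\<close> supply the poles at positive and at nonpositive integers; the logarithms cancel
  and the symmetric truncation remains.\<close>

lemma cot_partial_fractions:
  fixes a :: real
  assumes "a \<notin> \<int>"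
  shows "(\<lambda>N. \<Sum>n=-int N..int N. 1 / (a - of_int n)) \<longlonglongrightarrow> pi * cot (pi * a)"
proof -
  have "a \<noteq> 0" "1 - a \<noteq> 0" using assms by auto
  \<comment> \<open>The added null sequence \<open>1 / (a + of_nat N)\<close> is the pole at
    \<open>- N\<close>, which the truncated series for \<open>Digamma a\<close> just misses.\<close>
  have "(\<lambda>N. (of_real (ln (real N)) - (\<Sum>n<N. inverse ((1 - a) + of_nat n))) -
             (of_real (ln (real N)) - (\<Sum>n<N. inverse (a + of_nat n))) + 1 / (a + of_nat N))
          \<longlonglongrightarrow> Digamma (1 - a) - Digamma a + 0"
    by (intro tendsto_intros Digamma_LIMSEQ \<open>a \<noteq> 0\<close> \<open>1 - a \<noteq> 0\<close>) real_asymp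
  moreover have "(of_real (ln (real N)) - (\<Sum>n<N. inverse ((1 - a) + of_nat n))) -
             (of_real (ln (real N)) - (\<Sum>n<N. inverse (a + of_nat n))) + 1 / (a + of_nat N) =
             (\<Sum>n=-int N..int N. 1 / (a - of_int n))" for N
  proof -
    have "(\<Sum>n<N. inverse (a + of_nat n)) + 1 / (a + of_nat N) = (\<Sum>n<Suc N. inverse (a + of_nat n))"
      by (simp add: inverse_eq_divide)
    also have "\<dots> = 1 / a + (\<Sum>n<N. 1 / (a + real (Suc n)))"
      by (subst sum.lessThan_Suc_shift) (simp add: inverse_eq_divide)
    finally have 1: "(\<Sum>n<N. inverse (a + of_nat n)) + 1 / (a + of_nat N) = \<dots>" .
    have 2: "inverse ((1 - a) + of_nat n) = - (1 / (a - real (Suc n)))" for n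
    proof -
      have "(1 - a) + of_nat n = - (a - real (Suc n))" by simp
      thus ?thesis by (simp only: inverse_eq_divide divide_minus_right)
    qed
    show ?thesis
      unfolding sum_symmetric_int of_int_minus of_int_of_nat_eq diff_minus_eq_add sum.distrib 2 sum_negf
      using 1 by simp
  qed
  ultimately show ?thesis using Digamma_reflection_real[OF assms] by simp
qed

text \<open>For nonzero \<open>d\<close>, iterate 1 / ((d - x) x) = (1 / (d - x) + 1 / x) / d. For
  \<open>d = 0\<close> every quotient by a power of \<open>d\<close> has the junk value 0, and the
  last term alone equals the left side. In the application \<open>d = j - n\<close> and
  \<open>x = j - a\<close>, so \<open>d = 0\<close> is the diagonal.\<close>

lemma partial_fraction_shift:
  fixes d x :: real
  assumes "x \<noteq> 0" "d \<noteq> x" "p \<ge> 1"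
  shows "1 / (d - x) * (1 / x ^ p) = 1 / (d - x) * (1 / d ^ p)
    + (\<Sum>i=1..p. 1 / d ^ (p + 1 - i) * (1 / x ^ i)) - (if d = 0 then 1 / x ^ (p + 1) else 0)"
proof (cases "d = 0")
  case True
  have "(\<Sum>i=1..p. 1 / d ^ (p + 1 - i) * (1 / x ^ i)) = 0"
    by (intro sum.neutral) (auto simp: True power_0_left)
  thus ?thesis using assms True by (simp add: field_simps power_0_left)
next
  case False
  have "1 / (d - x) * (1 / x ^ p) - 1 / (d - x) * (1 / d ^ p) =
      (\<Sum>i=1..p. 1 / d ^ (p + 1 - i) * (1 / x ^ i))"
  proof (induction p)
    case (Suc p)
    have "(\<Sum>i=1..p. 1 / d ^ (Suc p + 1 - i) * (1 / x ^ i)) =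
        (\<Sum>i=1..p. 1 / d ^ (p + 1 - i) * (1 / x ^ i)) / d"
      unfolding sum_divide_distrib by (intro sum.cong) (auto simp: Suc_diff_le)
    hence *: "(\<Sum>i=1..Suc p. 1 / d ^ (Suc p + 1 - i) * (1 / x ^ i)) =
        (1 / (d - x) * (1 / x ^ p) - 1 / (d - x) * (1 / d ^ p)) / d + 1 / d * (1 / x ^ Suc p)"
      by (simp only: sum.cl_ivl_Suc Suc) simp
    have **: "1 / (d - x) * (A / x) - 1 / (d - x) * (B / d) =
        (1 / (d - x) * A - 1 / (d - x) * B) / d + 1 / d * (A / x)" for A B :: real
      using False assms by (simp add: divide_simps) (simp add: algebra_simps)
    show ?case
      unfolding * using **[of "1 / x ^ p" "1 / d ^ p"] by (simp add: mult_ac)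
  qed simp
  thus ?thesis using False by simp
qed

section \<open>Generalised harmonic numbers\<close>

lemma gen_harmonic_0 [simp]: "gen_harmonic 0 k = 0"
  by (simp add: gen_harmonic_def)

lemma gen_harmonic_Suc: "gen_harmonic (Suc n) k = gen_harmonic n k + 1 / real (Suc n) ^ k"
  by (simp add: gen_harmonic_def)

lemma gen_harmonic_eq_sum: "gen_harmonic n k = (\<Sum>j<n. 1 / real (Suc j) ^ k)"
  by (induction n) (simp_all add: gen_harmonic_Suc)

lemma gen_harmonic_add: "gen_harmonic (n + r) k = gen_harmonic n k + (\<Sum>i<r. 1 / real (Suc (n + i)) ^ k)"
  by (induction r) (simp_all add: gen_harmonic_Suc)

lemma gen_harmonic_nonneg: "gen_harmonic n k \<ge> 0"
  by (simp add: gen_harmonic_def sum_nonneg)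

lemma gen_harmonic_mono: "m \<le> n \<Longrightarrow> gen_harmonic m k \<le> gen_harmonic n k"
  unfolding gen_harmonic_def by (intro sum_mono2) auto

text \<open>The worst case is \<open>k = 1\<close>, where 1 / (n + 1) is at most 2 (sqrt (n + 1) -
  sqrt n), which telescopes. This crude growth is affordable against terms of order j^(-2).\<close>

lemma gen_harmonic_le_sqrt:
  assumes "k \<ge> 1"
  shows "gen_harmonic n k \<le> 2 * sqrt (real n)"
proof (induction n)
  case (Suc n)
  have "real (Suc n) ^ 1 \<le> real (Suc n) ^ k"
    using assms by (intro power_increasing) auto
  hence "1 / real (Suc n) ^ k \<le> 1 / real (Suc n)"
    by (intro divide_left_mono) auto
  also have "\<dots> \<le> 2 * sqrt (real (Suc n)) - 2 * sqrt (real n)"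
  proof -
    define u v where "u = sqrt (real (Suc n))" and "v = sqrt (real n)"
    have uv: "u > 0" "v \<ge> 0" "v \<le> u" "u ^ 2 = real (Suc n)" "v ^ 2 = real n"
      by (auto simp: u_def v_def)
    have "1 = (u - v) * (u + v)" using uv(4,5) by (simp add: algebra_simps power2_eq_square)
    also have "\<dots> \<le> (u - v) * (2 * u ^ 2)"
    proof (intro mult_left_mono)
      have "u \<ge> 1" by (simp add: u_def)
      hence "u * 1 \<le> u * u" using uv by (intro mult_left_mono) auto
      thus "u + v \<le> 2 * u ^ 2" using uv(3) unfolding power2_eq_square by linarith
    qed (use uv in auto)
    finally have "1 / real (Suc n) \<le> 2 * u - 2 * v"
      using uv by (simp add: field_simps)
    thus ?thesis by (simp add: u_def v_def)
  qed
  finally show ?case using Suc by (simp add: gen_harmonic_Suc)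
qed simp

text \<open>A fixed number \<open>r\<close> of terms, each tending to 0; thus the divergent case
  \<open>k = 1\<close> is covered too.\<close>

lemma gen_harmonic_shift_tendsto_0:
  assumes "k \<ge> 1"
  shows "(\<lambda>n. gen_harmonic (n + r) k - gen_harmonic n k) \<longlonglongrightarrow> 0"
proof -
  have "(\<lambda>n. 1 / real (Suc (n + i)) ^ k) \<longlonglongrightarrow> 0" for i
  proof -
    have "(\<lambda>n. (1 / real (Suc (n + i))) ^ k) \<longlonglongrightarrow> 0 ^ k"
      by (intro tendsto_power) real_asymp
    thus ?thesis using assms by (simp add: power_divide power_0_left)
  qed
  hence "(\<lambda>n. \<Sum>i<r. 1 / real (Suc (n + i)) ^ k) \<longlonglongrightarrow> (\<Sum>i<r. 0)"
    by (intro tendsto_sum)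
  thus ?thesis by (simp add: gen_harmonic_add)
qed

text \<open>The partial sums telescope to a vanishing block of \<open>n\<close> late terms minus the
  first \<open>n\<close> terms. Subtracting \<open>1 / real (Suc j) ^ k\<close> secures convergence
  also for \<open>k = 1\<close>.\<close>

lemma sums_shifted_difference_plus:
  assumes "k \<ge> 1"
  shows "(\<lambda>j. 1 / (real (Suc j) + real n) ^ k - 1 / real (Suc j) ^ k) sums (- gen_harmonic n k)"
proof -
  have *: "(\<Sum>j<J. 1 / (real (Suc j) + real n) ^ k - 1 / real (Suc j) ^ k) =
     (gen_harmonic (J + n) k - gen_harmonic J k) - gen_harmonic n k" for J
    by (subst add.commute, subst gen_harmonic_add)
       (simp add: gen_harmonic_eq_sum sum_subtractf add_ac)
  show ?thesis
    unfolding sums_def * using tendsto_diff[OF gen_harmonic_shift_tendsto_0[OF assms, of n] tendsto_const[of "gen_harmonic n k"]]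
    by simp
qed

text \<open>Indices below \<open>n\<close> have negative bases, and oddness of \<open>k\<close>
  turns them into \<open>- gen_harmonic n k\<close>. Index \<open>n\<close> contributes
  \<open>1 / 0 ^ k = 0\<close>, and the \<open>r\<close> indices after it give
  \<open>gen_harmonic r k\<close>.\<close>

lemma sum_shifted_minus:
  assumes "odd k"
  shows "(\<Sum>j<Suc n + r. 1 / (real (Suc j) - real (Suc n)) ^ k) = gen_harmonic r k - gen_harmonic n k"
proof (induction r)
  case 0
  have "(\<Sum>j<n. 1 / (real (Suc j) - real (Suc n)) ^ k) = (\<Sum>j<n. - (1 / real (Suc j) ^ k))"
  proof (rule sum.reindex_bij_witness[of _ "\<lambda>j. n - Suc j" "\<lambda>j. n - Suc j"])
    fix j assume "j \<in> {..<n}"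
    hence *: "real (Suc j) - real (Suc n) = - real (Suc (n - Suc j))" by auto
    show "- (1 / real (Suc (n - Suc j)) ^ k) = 1 / (real (Suc j) - real (Suc n)) ^ k"
      unfolding * power_minus_odd[OF assms] by simp
  qed auto
  moreover have "k \<noteq> 0" using assms by (cases k) auto
  ultimately show ?case by (simp add: gen_harmonic_eq_sum sum_negf)
next
  case (Suc r)
  have "real (Suc (Suc n + r)) - real (Suc n) = real (Suc r)" by simp
  hence "(\<Sum>j<Suc n + Suc r. 1 / (real (Suc j) - real (Suc n)) ^ k) =
      gen_harmonic r k - gen_harmonic n k + 1 / real (Suc r) ^ k"
    by (simp only: add_Suc_right sum.lessThan_Suc Suc)
  thus ?case by (simp add: gen_harmonic_Suc)
qed

text \<open>At \<open>j = n\<close> the junk value \<open>1 / 0 ^ k = 0\<close> omits the singular term.\<close>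

lemma sums_shifted_difference_minus:
  assumes "odd k"
  shows "(\<lambda>j. 1 / (real (Suc j) - real (Suc n)) ^ k - 1 / real (Suc j) ^ k) sums (- gen_harmonic n k)"
proof -
  have k: "k \<ge> 1" using assms by (cases k) auto
  have *: "(\<Sum>j<J + (n + 1). 1 / (real (Suc j) - real (Suc n)) ^ k - 1 / real (Suc j) ^ k) =
     - (gen_harmonic (J + (n + 1)) k - gen_harmonic J k) - gen_harmonic n k" for J
  proof -
    have "(\<Sum>j<J + (n + 1). 1 / (real (Suc j) - real (Suc n)) ^ k) = gen_harmonic J k - gen_harmonic n k"
      using sum_shifted_minus[OF assms, where n = n and r = J] by (simp add: add_ac)
    thus ?thesis unfolding sum_subtractf by (simp add: gen_harmonic_eq_sum)
  qed
  have "(\<lambda>J. \<Sum>j<J + (n + 1). 1 / (real (Suc j) - real (Suc n)) ^ k - 1 / real (Suc j) ^ k)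
     \<longlonglongrightarrow> - gen_harmonic n k"
    unfolding * using tendsto_diff[OF tendsto_minus[OF gen_harmonic_shift_tendsto_0[OF k, of "n + 1"]] tendsto_const[of "gen_harmonic n k"]]
    by simp
  thus ?thesis unfolding sums_def by (rule LIMSEQ_offset)
qed

lemma summable_inverse_power: "q \<ge> 2 \<Longrightarrow> summable (\<lambda>n. 1 / real (Suc n) ^ q)"
  using inverse_power_summable[of q, where 'a = real] unfolding inverse_eq_divide
  by (subst summable_Suc_iff[of "\<lambda>n. 1 / real n ^ q"])

lemma gen_harmonic_tendsto_zeta:
  assumes "q \<ge> 2"
  shows "(\<lambda>n. gen_harmonic n q) \<longlonglongrightarrow> zeta q"
  using summable_LIMSEQ[OF summable_inverse_power[OF assms]] assms
  by (simp add: gen_harmonic_eq_sum zeta_def)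

lemma gen_harmonic_le_zeta:
  assumes "q \<ge> 2"
  shows "gen_harmonic n q \<le> zeta q"
  using sum_le_suminf[OF summable_inverse_power[OF assms], of "{..<n}"] assms
  by (simp add: gen_harmonic_eq_sum zeta_def)

lemma gen_harmonic_diff_le: "gen_harmonic (n + r) k - gen_harmonic n k \<le> gen_harmonic r k"
proof -
  have "(\<Sum>i<r. 1 / real (Suc (n + i)) ^ k) \<le> (\<Sum>i<r. 1 / real (Suc i) ^ k)"
    by (intro sum_mono divide_left_mono power_mono) auto
  thus ?thesis by (simp add: gen_harmonic_add gen_harmonic_eq_sum[of r])
qed

section \<open>Two-sided power sums with the pole omitted\<close>

text \<open>The term \<open>n = j\<close>, if present, has the junk value \<open>1 / 0 ^ q = 0\<close>.\<close>

definition punctured_sum :: "nat \<Rightarrow> nat \<Rightarrow> nat \<Rightarrow> real" where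
  "punctured_sum q N j = (\<Sum>n=-int N..int N. 1 / (real j - of_int n) ^ q)"

text \<open>As long as \<open>N \<le> j\<close>, all differences \<open>Suc j - n\<close> are
  positive and form a block of consecutive integers. Beyond that, the negative ones form a second
  harmonic number with sign \<open>(-1) ^ q\<close>.\<close>

lemma punctured_sum_eq:
  assumes "q \<ge> 1"
  shows "punctured_sum q N (Suc j) =
    (if N \<le> j then gen_harmonic (N + Suc j) q - gen_harmonic (j - N) q
     else gen_harmonic (N + Suc j) q + (-1) ^ q * gen_harmonic (N - Suc j) q)"
proof (induction N)
  case 0
  show ?case by (simp add: punctured_sum_def gen_harmonic_Suc)
next
  case (Suc N)
  have step: "punctured_sum q (Suc N) (Suc j) = punctured_sum q N (Suc j)
      + (1 / (real j - real N) ^ q + 1 / real (Suc (N + Suc j)) ^ q)"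
    unfolding punctured_sum_def sum_symmetric_int by (simp add: add_ac)
  have top: "gen_harmonic (Suc N + Suc j) q = gen_harmonic (N + Suc j) q + 1 / real (Suc (N + Suc j)) ^ q"
    by (simp only: add_Suc gen_harmonic_Suc)
  \<comment> \<open>The new index \<open>Suc N\<close> has difference \<open>j - N\<close>; these
    are the cases of positive, zero and negative sign. At zero the new term is the omitted
    pole.\<close>
  consider "Suc N \<le> j" | "N = j" | "N > j" by linarith
  thus ?case
  proof cases
    case 1
    hence "j - N = Suc (j - Suc N)" "real j - real N = real (Suc (j - Suc N))" by auto
    hence "gen_harmonic (j - N) q = gen_harmonic (j - Suc N) q + 1 / (real j - real N) ^ q"
      by (simp only: gen_harmonic_Suc)
    with 1 show ?thesis unfolding step top Suc by simp
  next
    case 2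
    thus ?thesis unfolding step top Suc using assms by (simp add: power_0_left)
  next
    case 3
    hence "Suc N - Suc j = Suc (N - Suc j)" "real j - real N = - real (Suc (N - Suc j))" by auto
    hence "gen_harmonic (Suc N - Suc j) q = gen_harmonic (N - Suc j) q + 1 / real (Suc (N - Suc j)) ^ q"
      "1 / (real j - real N) ^ q = (-1) ^ q * (1 / real (Suc (N - Suc j)) ^ q)"
      by (simp only: gen_harmonic_Suc, simp only: power_minus[of "real (Suc _)"])
         (auto simp: field_simps power_mult_distrib [symmetric])
    with 3 show ?thesis unfolding step top Suc by (simp add: algebra_simps)
  qed
qed

text \<open>A bound independent of \<open>N\<close>, as dominated convergence requires. For odd
  \<open>q\<close> the two sides cancel up to at most \<open>2 * Suc j\<close> terms, whose sum
  grows like a square root; for even \<open>q\<close> each side is at most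
  \<open>zeta q\<close>.\<close>

lemma punctured_sum_bound:
  assumes "q \<ge> 1"
  obtains C where "\<And>N j. \<bar>punctured_sum q N (Suc j)\<bar> \<le> C * sqrt (real (Suc j))"
proof (cases "odd q")
  case True
  have "\<bar>punctured_sum q N (Suc j)\<bar> \<le> (2 * sqrt 2) * sqrt (real (Suc j))" for N j
  proof -
    have "0 \<le> punctured_sum q N (Suc j) \<and> punctured_sum q N (Suc j) \<le> gen_harmonic (2 * Suc j) q"
    proof (cases "N \<le> j")
      case True
      thus ?thesis
        using gen_harmonic_mono[of "j - N" "N + Suc j" q] gen_harmonic_mono[of "N + Suc j" "2 * Suc j" q]
          gen_harmonic_nonneg[of "j - N" q]
        unfolding punctured_sum_eq[OF assms] by simp
    next
      case False
      hence eq: "(N - Suc j) + 2 * Suc j = N + Suc j" by simp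
      thus ?thesis
        using gen_harmonic_mono[of "N - Suc j" "N + Suc j" q] \<open>odd q\<close> False
          gen_harmonic_diff_le[of "N - Suc j" "2 * Suc j" q, unfolded eq]
        unfolding punctured_sum_eq[OF assms] by simp
    qed
    moreover have "gen_harmonic (2 * Suc j) q \<le> 2 * sqrt (real (2 * Suc j))"
      using assms by (rule gen_harmonic_le_sqrt)
    moreover have "sqrt (real (2 * Suc j)) = sqrt 2 * sqrt (real (Suc j))"
      by (simp only: of_nat_mult real_sqrt_mult of_nat_numeral)
    ultimately show ?thesis by simp
  qed
  thus ?thesis by (rule that)
next
  case False
  hence q: "q \<ge> 2" using assms by (cases "q = 1") auto
  have "\<bar>punctured_sum q N (Suc j)\<bar> \<le> (2 * zeta q) * sqrt (real (Suc j))" for N j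
  proof -
    have *: "0 \<le> gen_harmonic n q" "gen_harmonic n q \<le> zeta q" for n
      using gen_harmonic_nonneg gen_harmonic_le_zeta[OF q] by auto
    have "\<bar>punctured_sum q N (Suc j)\<bar> \<le> (2 * zeta q) * 1"
      using *[of "N + Suc j"] *[of "j - N"] *[of "N - Suc j"] False
      unfolding punctured_sum_eq[OF assms] by auto
    also have "\<dots> \<le> (2 * zeta q) * sqrt (real (Suc j))"
      using *[of 0] by (intro mult_left_mono) auto
    finally show ?thesis .
  qed
  thus ?thesis by (rule that)
qed

text \<open>For large \<open>N\<close> two harmonic numbers remain whose lengths differ by
  \<open>2 * Suc j\<close>. They add up to twice \<open>zeta q\<close> in the limit for even
  \<open>q\<close> and cancel for odd \<open>q\<close>, including \<open>q = 1\<close>.\<close>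

lemma punctured_sum_tendsto:
  assumes "q \<ge> 1"
  shows "(\<lambda>N. punctured_sum q N (Suc j)) \<longlonglongrightarrow> (if even q then 2 * zeta q else 0)"
proof (rule LIMSEQ_offset)
  have *: "punctured_sum q (N + Suc j) (Suc j) =
      gen_harmonic (N + 2 * Suc j) q + (-1) ^ q * gen_harmonic N q" for N
  proof -
    have "N + Suc j + Suc j = N + 2 * Suc j" "N + Suc j - Suc j = N" "\<not> N + Suc j \<le> j" by simp_all
    thus ?thesis by (simp only: punctured_sum_eq[OF assms] if_False)
  qed
  show "(\<lambda>N. punctured_sum q (N + Suc j) (Suc j)) \<longlonglongrightarrow> (if even q then 2 * zeta q else 0)"
  proof (cases "even q")
    case True
    hence q: "q \<ge> 2" using assms by (cases "q = 1") auto
    have "(\<lambda>N. gen_harmonic (N + 2 * Suc j) q + gen_harmonic N q) \<longlonglongrightarrow> zeta q + zeta q"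
      by (intro tendsto_add LIMSEQ_ignore_initial_segment gen_harmonic_tendsto_zeta q)
    thus ?thesis using True unfolding * by simp
  next
    case False
    thus ?thesis unfolding * using gen_harmonic_shift_tendsto_0[OF assms, of "2 * Suc j"] by simp
  qed
qed

section \<open>Quadratic decay and summability\<close>

lemma summable_sqrt_mult:
  fixes f :: "nat \<Rightarrow> real"
  assumes "f \<in> O(\<lambda>j. 1 / real j ^ 2)"
  shows "summable (\<lambda>j. sqrt (real (Suc j)) * \<bar>f j\<bar>)"
proof (rule summable_comparison_test_bigo)
  show "summable (\<lambda>j. norm (real j powr (-3/2)))"
    by (simp add: summable_real_powr_iff)
  \<comment> \<open>The square root costs half a power; the remaining exponent -3/2 is still
    summable.\<close>
  have "(\<lambda>j. sqrt (real (Suc j)) * \<bar>f j\<bar>) \<in> O(\<lambda>j. sqrt (real (Suc j)) * (1 / real j ^ 2))"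
    using assms by (intro landau_o.big.mult) auto
  also have "(\<lambda>j. sqrt (real (Suc j)) * (1 / real j ^ 2)) \<in> O(\<lambda>j. real j powr (-3/2))"
    by real_asymp
  finally show "(\<lambda>j. sqrt (real (Suc j)) * \<bar>f j\<bar>) \<in> O(\<lambda>j. real j powr (-3/2))" .
qed

lemma bigo_power_ge_2:
  fixes f :: "nat \<Rightarrow> real"
  assumes "f \<in> O(\<lambda>j. 1 / real j)" "i \<ge> 2"
  shows "(\<lambda>j. f j ^ i) \<in> O(\<lambda>j. 1 / real j ^ 2)"
proof -
  obtain r where i: "i = 2 + r" using assms(2) le_Suc_ex by blast
  have "f \<in> O(\<lambda>_. 1)"
    using assms(1) by (rule landau_o.big_trans) real_asymp
  hence "(\<lambda>j. f j ^ r) \<in> O(\<lambda>_. 1 ^ r)" by (rule landau_o.big_power)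
  moreover have "(\<lambda>j. f j ^ 2) \<in> O(\<lambda>j. (1 / real j) ^ 2)" using assms(1) by (rule landau_o.big_power)
  ultimately have "(\<lambda>j. f j ^ 2 * f j ^ r) \<in> O(\<lambda>j. (1 / real j) ^ 2 * 1 ^ r)"
    by (intro landau_o.big.mult)
  thus ?thesis unfolding i power_add by (simp add: power_divide)
qed

lemma recip_power_bigo:
  fixes a :: real
  assumes "i \<ge> 2"
  shows "(\<lambda>j. 1 / (real (Suc j) + a) ^ i) \<in> O(\<lambda>j. 1 / real j ^ 2)"
proof -
  have "(\<lambda>j. 1 / (real (Suc j) + a)) \<in> O(\<lambda>j. 1 / real j)" by real_asymp
  from bigo_power_ge_2[OF this assms] show ?thesis by (simp add: power_divide)
qed

text \<open>For \<open>i \<ge> 2\<close> each reciprocal decays quadratically by itself; only for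
  \<open>i = 1\<close> do the leading terms \<open>1 / j\<close> have to cancel.\<close>

lemma recip_diff_bigo:
  fixes a :: real
  assumes "i \<ge> 1"
  shows "(\<lambda>j. 1 / (real (Suc j) - a) ^ i - 1 / (real (Suc j) + a) ^ i) \<in> O(\<lambda>j. 1 / real j ^ 2)"
proof (cases "i = 1")
  case True
  have "(\<lambda>j. 1 / (real (Suc j) - a) - 1 / (real (Suc j) + a)) \<in> O(\<lambda>j. 1 / real j ^ 2)"
    by real_asymp
  thus ?thesis by (simp add: True)
next
  case False
  hence "i \<ge> 2" using assms by simp
  from recip_power_bigo[OF this, of a] recip_power_bigo[OF this, of "-a"]
  show ?thesis by (intro sum_in_bigo) simp_all
qed

lemma recip_second_diff_bigo:
  fixes a :: real
  assumes "i \<ge> 1"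
  shows "(\<lambda>j. 1 / (real (Suc j) - a) ^ i + 1 / (real (Suc j) + a) ^ i - 2 / real (Suc j) ^ i)
     \<in> O(\<lambda>j. 1 / real j ^ 2)"
proof (cases "i = 1")
  case True
  have "(\<lambda>j. 1 / (real (Suc j) - a) + 1 / (real (Suc j) + a) - 2 / real (Suc j)) \<in> O(\<lambda>j. 1 / real j ^ 2)"
    by real_asymp
  thus ?thesis by (simp add: True)
next
  case False
  hence "i \<ge> 2" using assms by simp
  from recip_power_bigo[OF this, of a] recip_power_bigo[OF this, of "-a"]
    landau_o.big.cmult_in_iff[THEN iffD2, OF _ recip_power_bigo[OF this, of 0], of 2]
  show ?thesis by (intro sum_in_bigo) simp_all
qed

lemma bigo_inverse_square_imp_summable:
  fixes f :: "nat \<Rightarrow> real"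
  assumes "f \<in> O(\<lambda>j. 1 / real j ^ 2)"
  shows "summable f"
proof (rule summable_comparison_test_bigo[OF _ assms])
  show "summable (\<lambda>j. norm (1 / real j ^ 2))"
    using inverse_power_summable[of 2, where 'a = real] by (simp add: inverse_eq_divide)
qed

section \<open>The product of the cotangent and the polygamma-type series\<close>

text \<open>This is \<open>partial_fraction_shift\<close> with \<open>d = Suc j - n\<close>, once
  for \<open>x = Suc j - a\<close> and once for \<open>x = Suc j + a\<close>. Summed over
  \<open>n\<close>, the powers of \<open>1 / d\<close> become punctured sums.\<close>

lemma cot_truncated_mult_term:
  fixes a :: real
  assumes a: "a \<notin> \<int>" and p: "p \<ge> 1"
  defines "c \<equiv> \<lambda>n. 1 / (a - of_int n) + 1 / (a + of_int n)"
  defines "g \<equiv> \<lambda>i j. 1 / (real (Suc j) - a) ^ i - 1 / (real (Suc j) + a) ^ i"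
  shows "(\<Sum>n=-int N..int N. 1 / (a - of_int n)) *
      (1 / (real (Suc j) - a) ^ p + 1 / (real (Suc j) + a) ^ p - 2 / real (Suc j) ^ p) =
    (\<Sum>n=-int N..int N. (1 / (real (Suc j) - of_int n) ^ p - 1 / real (Suc j) ^ p) * c n)
    + (\<Sum>i=1..p. punctured_sum (p + 1 - i) N (Suc j) * g i j)
    - (if j < N then g (p + 1) j else 0)"
proof -
  define x where "x = real (Suc j)"
  have nonint: "a \<noteq> of_int n" "of_int n - a \<noteq> 0" "of_int n + a \<noteq> 0" "a + of_int n \<noteq> 0" for n :: int
  proof -
    have "a \<noteq> of_int n" for n :: int using a by auto
    from this[of n] this[of "- n"]
    show "a \<noteq> of_int n" "of_int n - a \<noteq> 0" "of_int n + a \<noteq> 0" "a + of_int n \<noteq> 0" by auto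
  qed
  have x: "x - a \<noteq> 0" "x + a \<noteq> 0" using nonint[of "int (Suc j)"] by (auto simp: x_def)
  \<comment> \<open>Reflecting \<open>n\<close> in the half that belongs to \<open>x + a\<close>
    gives both halves the same differences \<open>x - of_int n\<close>, so their expansions combine
    into \<open>g\<close>.\<close>
  have reflect: "(\<Sum>n=-int N..int N. 1 / (a - of_int n)) = (\<Sum>n=-int N..int N. 1 / (a + of_int n))"
    by (rule sum.reindex_bij_witness[of _ uminus uminus]) auto
  have pf: "1 / (a - of_int n) * (1 / (x - a) ^ p - 1 / x ^ p)
        + 1 / (a + of_int n) * (1 / (x + a) ^ p - 1 / x ^ p) =
      (1 / (x - of_int n) ^ p - 1 / x ^ p) * c n
      + (\<Sum>i=1..p. 1 / (x - of_int n) ^ (p + 1 - i) * g i j)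
      - (if n = int (Suc j) then g (p + 1) j else 0)" for n :: int
  proof -
    have d: "x - of_int n = 0 \<longleftrightarrow> n = int (Suc j)" unfolding x_def by linarith
    have 1: "(x - of_int n) - (x - a) = a - of_int n" by simp
    have 2: "1 / ((x - of_int n) - (x + a)) = - (1 / (a + of_int n))"
      by (metis (no_types) add_diff_cancel_left' divide_minus_right minus_add_distrib
          diff_diff_eq diff_minus_eq_add minus_diff_eq uminus_add_conv_diff add.commute)
    have A: "1 / (a - of_int n) * (1 / (x - a) ^ p) = 1 / (a - of_int n) * (1 / (x - of_int n) ^ p)
       + (\<Sum>i=1..p. 1 / (x - of_int n) ^ (p + 1 - i) * (1 / (x - a) ^ i))
       - (if n = int (Suc j) then 1 / (x - a) ^ (p + 1) else 0)"
      using partial_fraction_shift[of "x - a" "x - of_int n" p] x p nonint[of n] unfolding 1 d by simp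
    have B: "- (1 / (a + of_int n)) * (1 / (x + a) ^ p) = - (1 / (a + of_int n)) * (1 / (x - of_int n) ^ p)
       + (\<Sum>i=1..p. 1 / (x - of_int n) ^ (p + 1 - i) * (1 / (x + a) ^ i))
       - (if n = int (Suc j) then 1 / (x + a) ^ (p + 1) else 0)"
    proof -
      have "x - of_int n \<noteq> x + a" using nonint[of n] by auto
      from partial_fraction_shift[OF x(2) this p] show ?thesis unfolding 2 d .
    qed
    have C: "(\<Sum>i=1..p. 1 / (x - of_int n) ^ (p + 1 - i) * g i j) =
       (\<Sum>i=1..p. 1 / (x - of_int n) ^ (p + 1 - i) * (1 / (x - a) ^ i))
       - (\<Sum>i=1..p. 1 / (x - of_int n) ^ (p + 1 - i) * (1 / (x + a) ^ i))"
      by (simp add: g_def x_def right_diff_distrib sum_subtractf)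
    have D: "(if n = int (Suc j) then g (p + 1) j else 0) =
       (if n = int (Suc j) then 1 / (x - a) ^ (p + 1) else 0)
       - (if n = int (Suc j) then 1 / (x + a) ^ (p + 1) else 0)"
      by (simp add: g_def x_def)
    show ?thesis using A B unfolding C D c_def right_diff_distrib left_diff_distrib distrib_left
      by (simp only: mult_minus_left mult.commute[of "1 / (x - of_int n) ^ p"] mult.commute[of "1 / x ^ p"])
  qed
  have "(\<Sum>n=-int N..int N. 1 / (a - of_int n)) * (1 / (x - a) ^ p + 1 / (x + a) ^ p - 2 / x ^ p) =
     (\<Sum>n=-int N..int N. 1 / (a - of_int n)) * (1 / (x - a) ^ p - 1 / x ^ p)
     + (\<Sum>n=-int N..int N. 1 / (a + of_int n)) * (1 / (x + a) ^ p - 1 / x ^ p)"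
    unfolding reflect by (simp add: algebra_simps)
  also have "\<dots> = (\<Sum>n=-int N..int N. 1 / (a - of_int n) * (1 / (x - a) ^ p - 1 / x ^ p)
        + 1 / (a + of_int n) * (1 / (x + a) ^ p - 1 / x ^ p))"
    by (simp only: sum.distrib sum_distrib_right)
  also have "\<dots> = (\<Sum>n=-int N..int N. (1 / (x - of_int n) ^ p - 1 / x ^ p) * c n)
      + (\<Sum>n=-int N..int N. \<Sum>i=1..p. 1 / (x - of_int n) ^ (p + 1 - i) * g i j)
      - (\<Sum>n=-int N..int N. if n = int (Suc j) then g (p + 1) j else 0)"
    unfolding pf by (simp only: sum.distrib sum_subtractf)
  also have "(\<Sum>n=-int N..int N. \<Sum>i=1..p. 1 / (x - of_int n) ^ (p + 1 - i) * g i j) =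
      (\<Sum>i=1..p. punctured_sum (p + 1 - i) N (Suc j) * g i j)"
    unfolding punctured_sum_def x_def by (subst sum.swap) (simp only: sum_distrib_right)
  also have "(\<Sum>n=-int N..int N. if n = int (Suc j) then g (p + 1) j else 0) =
      (if j < N then g (p + 1) j else 0)"
    by (subst sum.delta) auto
  finally show ?thesis unfolding x_def .
qed

text \<open>Summation over \<open>j\<close> turns each difference into a negated harmonic number.
  The weight is even in \<open>n\<close>, so the indices \<open>Suc n\<close> and
  \<open>- Suc n\<close> can be paired.\<close>

lemma sums_shifted_kernel:
  assumes "odd p"
  shows "(\<lambda>j. \<Sum>n=-int N..int N. (1 / (real (Suc j) - of_int n) ^ p - 1 / real (Suc j) ^ p)
            * (1 / (a - of_int n) + 1 / (a + of_int n))) sums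
         (\<Sum>n<N. - (gen_harmonic n p + gen_harmonic (Suc n) p)
            * (1 / (a - real (Suc n)) + 1 / (a + real (Suc n))))"
proof -
  have p: "p \<ge> 1" using assms by (cases p) auto
  \<comment> \<open>The two signs differ by one term: for positive \<open>n\<close> the singular
    index is left out, and only the \<open>n - 1\<close> negative bases before it survive the
    cancellation.\<close>
  define K where "K = (\<lambda>n. if n \<le> 0 then - gen_harmonic (nat (-n)) p else - gen_harmonic (nat n - 1) p)"
  have *: "(\<lambda>j. 1 / (real (Suc j) - of_int n) ^ p - 1 / real (Suc j) ^ p) sums K n" for n
  proof (cases "n \<le> 0")
    case True
    thus ?thesis using sums_shifted_difference_plus[OF p, of "nat (-n)"] by (simp add: K_def)
  next
    case False
    hence "of_int n = real (Suc (nat n - 1))" by linarith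
    thus ?thesis using sums_shifted_difference_minus[OF assms, of "nat n - 1"] False
      by (simp only: K_def if_False)
  qed
  have "(\<lambda>j. \<Sum>n=-int N..int N. (1 / (real (Suc j) - of_int n) ^ p - 1 / real (Suc j) ^ p)
            * (1 / (a - of_int n) + 1 / (a + of_int n))) sums
         (\<Sum>n=-int N..int N. K n * (1 / (a - of_int n) + 1 / (a + of_int n)))"
    by (intro sums_sum sums_mult2 *)
  also have "(\<Sum>n=-int N..int N. K n * (1 / (a - of_int n) + 1 / (a + of_int n))) =
      (\<Sum>n<N. - (gen_harmonic n p + gen_harmonic (Suc n) p)
            * (1 / (a - real (Suc n)) + 1 / (a + real (Suc n))))"
    unfolding sum_symmetric_int
  proof -
    have "K (int (Suc n)) * (1 / (a - of_int (int (Suc n))) + 1 / (a + of_int (int (Suc n))))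
        + K (- int (Suc n)) * (1 / (a - of_int (- int (Suc n))) + 1 / (a + of_int (- int (Suc n)))) =
        - (gen_harmonic n p + gen_harmonic (Suc n) p)
            * (1 / (a - real (Suc n)) + 1 / (a + real (Suc n)))" for n
    proof -
      have K: "K (int (Suc n)) = - gen_harmonic n p" "K (- int (Suc n)) = - gen_harmonic (Suc n) p"
        by (simp_all add: K_def nat_add_distrib flip: of_nat_Suc)
      show ?thesis unfolding K by (simp add: algebra_simps)
    qed
    thus "K 0 * (1 / (a - of_int 0) + 1 / (a + of_int 0)) + (\<Sum>n<N.
        K (int (Suc n)) * (1 / (a - of_int (int (Suc n))) + 1 / (a + of_int (int (Suc n))))
        + K (- int (Suc n)) * (1 / (a - of_int (- int (Suc n))) + 1 / (a + of_int (- int (Suc n))))) =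
      (\<Sum>n<N. - (gen_harmonic n p + gen_harmonic (Suc n) p)
            * (1 / (a - real (Suc n)) + 1 / (a + real (Suc n))))"
      by (simp only:) (simp add: K_def)
  qed
  finally show ?thesis .
qed

text \<open>Tannery's theorem with the majorant from \<open>punctured_sum_bound\<close>: the limit
  in \<open>N\<close> passes under the sum over \<open>j\<close>.\<close>

lemma punctured_sum_series_tendsto:
  fixes f :: "nat \<Rightarrow> real"
  assumes "q \<ge> 1" "f \<in> O(\<lambda>j. 1 / real j ^ 2)"
  shows "summable (\<lambda>j. punctured_sum q N (Suc j) * f j)"
    and "(\<lambda>N. \<Sum>j. punctured_sum q N (Suc j) * f j) \<longlonglongrightarrow> (if even q then 2 * zeta q else 0) * (\<Sum>j. f j)"
proof -
  obtain C where C: "\<And>N j. \<bar>punctured_sum q N (Suc j)\<bar> \<le> C * sqrt (real (Suc j))"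
    using punctured_sum_bound[OF assms(1)] by blast
  define M where "M = (\<lambda>j. C * (sqrt (real (Suc j)) * \<bar>f j\<bar>))"
  have M: "summable M"
    unfolding M_def by (intro summable_mult summable_sqrt_mult assms)
  have bound: "norm (punctured_sum q N (Suc j) * f j) \<le> M j" for N j
    using mult_right_mono[OF C[of N j], of "\<bar>f j\<bar>"] by (simp add: M_def abs_mult mult_ac)
  show "summable (\<lambda>j. punctured_sum q N (Suc j) * f j)"
    using M bound by (rule summable_comparison_test'[where N = 0])
  have "(\<lambda>N. \<Sum>j. punctured_sum q N (Suc j) * f j) \<longlonglongrightarrow> (\<Sum>j. (if even q then 2 * zeta q else 0) * f j)"
  proof (rule tannerys_theorem[THEN conjunct2, THEN conjunct2])
    show "(\<lambda>N. punctured_sum q N (Suc j) * f j) \<longlonglongrightarrow> (if even q then 2 * zeta q else 0) * f j" for j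
      by (intro tendsto_mult punctured_sum_tendsto assms tendsto_const)
    show "\<forall>\<^sub>F (j, N) in at_top \<times>\<^sub>F sequentially. norm (punctured_sum q N (Suc j) * f j) \<le> M j"
      using bound by (intro always_eventually) auto
  qed (use M in auto)
  thus "(\<lambda>N. \<Sum>j. punctured_sum q N (Suc j) * f j) \<longlonglongrightarrow> (if even q then 2 * zeta q else 0) * (\<Sum>j. f j)"
    using suminf_mult[OF bigo_inverse_square_imp_summable[OF assms(2)]] by simp
qed

text \<open>
  Antisymmetrising in \<open>a\<close> makes the terms of every series over \<open>j\<close> \<open>O(j\<^sup>-\<^sup>2)\<close>, so \<open>N \<rightarrow> \<infinity>\<close> may be taken
  termwise. Without it the case \<open>p = 1\<close> would pick up an extra constant.
\<close>

lemma harmonic_pair_sums: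
  fixes a :: real and m :: nat
  assumes a: "a \<notin> \<int>"
  defines "p \<equiv> 2 * m + 1"
  defines "g \<equiv> \<lambda>i j. 1 / (real (Suc j) - a) ^ i - 1 / (real (Suc j) + a) ^ i"
  shows "(\<lambda>n. (gen_harmonic n p + gen_harmonic (Suc n) p) * (2 * a / (real (Suc n) ^ 2 - a ^ 2))) sums
    (pi * cot (pi * a) * (\<Sum>j. 1 / (real (Suc j) - a) ^ p + 1 / (real (Suc j) + a) ^ p - 2 / real (Suc j) ^ p)
      - 2 * (\<Sum>k=0..m. zeta (2 * k) * (\<Sum>j. g (2 * m - 2 * k + 2) j)))"
proof -
  have p: "p \<ge> 1" "odd p" by (auto simp: p_def)
  define u where "u = (\<lambda>j. 1 / (real (Suc j) - a) ^ p + 1 / (real (Suc j) + a) ^ p - 2 / real (Suc j) ^ p)"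
  define D where "D = (\<lambda>N. \<Sum>n=-int N..int N. 1 / (a - of_int n))"
  define R where "R = (\<lambda>N. \<Sum>i=1..p. \<Sum>j. punctured_sum (p + 1 - i) N (Suc j) * g i j)"
  have g: "g i \<in> O(\<lambda>j. 1 / real j ^ 2)" if "i \<ge> 1" for i
    unfolding g_def using that by (rule recip_diff_bigo)
  have u: "summable u"
    unfolding u_def by (intro bigo_inverse_square_imp_summable recip_second_diff_bigo p)
  \<comment> \<open>For fixed \<open>N\<close> the series of \<open>D N * u j\<close> over
    \<open>j\<close> is evaluated twice, as a multiple of the series of \<open>u\<close> and through
    \<open>cot_truncated_mult_term\<close>.\<close>
  have key: "(\<Sum>n<N. (gen_harmonic n p + gen_harmonic (Suc n) p) * (2 * a / (real (Suc n) ^ 2 - a ^ 2))) =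
      D N * (\<Sum>j. u j) - R N + (\<Sum>j<N. g (p + 1) j)" for N
  proof -
    define V where "V = (\<Sum>n<N. - (gen_harmonic n p + gen_harmonic (Suc n) p)
            * (1 / (a - real (Suc n)) + 1 / (a + real (Suc n))))"
    have "(\<lambda>j. D N * u j) sums (D N * (\<Sum>j. u j))"
      using u by (intro sums_mult summable_sums)
    moreover have "(\<lambda>j. D N * u j) sums (V + R N - (\<Sum>j<N. g (p + 1) j))"
      unfolding D_def u_def cot_truncated_mult_term[OF a p(1)] V_def R_def
    proof (intro sums_diff sums_add sums_shifted_kernel p sums_sum, goal_cases)
      case (1 i)
      hence "summable (\<lambda>j. punctured_sum (p + 1 - i) N (Suc j) * g i j)"
        by (intro punctured_sum_series_tendsto g) auto
      from summable_sums[OF this] show ?case by (simp only: g_def)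
    next
      case 2
      show ?case
        using sums_If_finite[OF finite_Collect_less_nat, of N "g (p + 1)"] by (simp only: lessThan_def g_def)
    qed
    ultimately have "D N * (\<Sum>j. u j) = V + R N - (\<Sum>j<N. g (p + 1) j)"
      by (rule sums_unique2)
    moreover have "V = (\<Sum>n<N. (gen_harmonic n p + gen_harmonic (Suc n) p) * (2 * a / (real (Suc n) ^ 2 - a ^ 2)))"
      unfolding V_def
    proof (intro sum.cong refl)
      fix n
      have "a - real (Suc n) \<noteq> 0" "a + real (Suc n) \<noteq> 0"
        using a by (metis Ints_of_nat eq_iff_diff_eq_0, metis Ints_minus Ints_of_nat add_eq_0_iff2)
      moreover have "real (Suc n) ^ 2 - a ^ 2 = - ((a - real (Suc n)) * (a + real (Suc n)))"
        by (simp add: algebra_simps power2_eq_square)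
      ultimately have "1 / (a - real (Suc n)) + 1 / (a + real (Suc n)) = - (2 * a / (real (Suc n) ^ 2 - a ^ 2))"
        by (simp add: add_frac_eq)
      thus "- (gen_harmonic n p + gen_harmonic (Suc n) p) * (1 / (a - real (Suc n)) + 1 / (a + real (Suc n))) =
        (gen_harmonic n p + gen_harmonic (Suc n) p) * (2 * a / (real (Suc n) ^ 2 - a ^ 2))"
        by (simp only: minus_mult_minus)
    qed
    ultimately show ?thesis by linarith
  qed
  have "(\<lambda>N. D N * (\<Sum>j. u j) - R N + (\<Sum>j<N. g (p + 1) j)) \<longlonglongrightarrow>
      pi * cot (pi * a) * (\<Sum>j. u j)
      - (\<Sum>i=1..p. (if even (p + 1 - i) then 2 * zeta (p + 1 - i) else 0) * (\<Sum>j. g i j))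
      + (\<Sum>j. g (p + 1) j)"
    unfolding D_def R_def
    by (intro tendsto_intros cot_partial_fractions a punctured_sum_series_tendsto g summable_LIMSEQ
        bigo_inverse_square_imp_summable) auto
  also have "(\<Sum>i=1..p. (if even (p + 1 - i) then 2 * zeta (p + 1 - i) else 0) * (\<Sum>j. g i j)) =
      (\<Sum>i\<in>{i\<in>{1..p}. even (p + 1 - i)}. 2 * zeta (p + 1 - i) * (\<Sum>j. g i j))"
    by (subst sum.inter_filter) (auto intro!: sum.cong)
  also have "\<dots> = (\<Sum>k=1..m. 2 * zeta (2 * k) * (\<Sum>j. g (2 * m - 2 * k + 2) j))"
  proof -
    \<comment> \<open>Solving \<open>p + 1 - i = 2 * k\<close> with \<open>p = 2 * m + 1\<close>
      gives the reindexing.\<close>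
    have "{i\<in>{1..p}. even (p + 1 - i)} = (\<lambda>k. 2 * m - 2 * k + 2) ` {1..m}"
    proof (intro equalityI subsetI)
      fix i assume "i \<in> {i\<in>{1..p}. even (p + 1 - i)}"
      then obtain r where "i = 2 * r" "r \<ge> 1" "r \<le> m"
        by (auto simp: p_def elim!: evenE)
      thus "i \<in> (\<lambda>k. 2 * m - 2 * k + 2) ` {1..m}"
        by (intro image_eqI[of _ _ "m + 1 - r"]) auto
    qed (auto simp: p_def)
    moreover have "inj_on (\<lambda>k. 2 * m - 2 * k + 2) {1..m}"
      by (auto simp: inj_on_def)
    ultimately show ?thesis
      by (simp only: sum.reindex comp_def) (auto simp: p_def intro!: sum.cong)
  qed
  finally have "(\<lambda>N. D N * (\<Sum>j. u j) - R N + (\<Sum>j<N. g (p + 1) j)) \<longlonglongrightarrow>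
      pi * cot (pi * a) * (\<Sum>j. u j)
      - (\<Sum>k=1..m. 2 * zeta (2 * k) * (\<Sum>j. g (2 * m - 2 * k + 2) j)) + (\<Sum>j. g (p + 1) j)" .
  \<comment> \<open>Since \<open>zeta 0 = - 1 / 2\<close>, the diagonal series of
    \<open>g (p + 1)\<close> is the missing term \<open>k = 0\<close>.\<close>
  also have "(\<Sum>k=1..m. 2 * zeta (2 * k) * (\<Sum>j. g (2 * m - 2 * k + 2) j)) - (\<Sum>j. g (p + 1) j) =
      2 * (\<Sum>k=0..m. zeta (2 * k) * (\<Sum>j. g (2 * m - 2 * k + 2) j))"
    by (simp add: sum.atLeast_Suc_atMost sum_distrib_left zeta_def p_def mult_ac)
  hence "pi * cot (pi * a) * (\<Sum>j. u j)
      - (\<Sum>k=1..m. 2 * zeta (2 * k) * (\<Sum>j. g (2 * m - 2 * k + 2) j)) + (\<Sum>j. g (p + 1) j) =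
      pi * cot (pi * a) * (\<Sum>j. u j) - 2 * (\<Sum>k=0..m. zeta (2 * k) * (\<Sum>j. g (2 * m - 2 * k + 2) j))"
    by linarith
  finally show ?thesis unfolding sums_def key u_def .
qed

section \<open>Euler sums by comparison of power series\<close>

text \<open>Turns a sum over \<open>n\<close> of \<open>g (a / Suc n)\<close> into a power series in
  \<open>a\<close> whose coefficients are Dirichlet series. Nonnegativity of \<open>w\<close> and
  \<open>b\<close>, together with exponents of at least 2, bounds all partial sums over
  \<open>s\<close> by \<open>w n / real (Suc n) ^ 2 * g a\<close>, so Tannery's theorem
  applies.\<close>

lemma even_series_exchange:
  fixes w b :: "nat \<Rightarrow> real" and g :: "real \<Rightarrow> real"
  assumes w: "\<And>n. 0 \<le> w n" "summable (\<lambda>n. w n / real (Suc n) ^ 2)"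
    and b: "\<And>s. 0 \<le> b s" "\<And>x. \<bar>x\<bar> < 1 \<Longrightarrow> (\<lambda>s. b s * x ^ (2 * s + 2)) sums g x"
    and a: "\<bar>a\<bar> < 1"
  shows "(\<lambda>s. b s * (\<Sum>n. w n / real (Suc n) ^ (2 * s + 2)) * a ^ (2 * s + 2)) sums
           (\<Sum>n. w n * g (a / real (Suc n)))"
proof -
  define M where "M = (\<lambda>n. w n / real (Suc n) ^ 2 * g a)"
  define F where "F = (\<lambda>n S. \<Sum>s<S. w n * (b s * (a / real (Suc n)) ^ (2 * s + 2)))"
  have M: "summable M" unfolding M_def by (intro summable_mult2 w)
  have even: "x ^ (2 * s + 2) \<ge> 0" for x :: real and s
    by (metis even_Suc_Suc_iff even_mult_iff even_numeral add_2_eq_Suc' zero_le_even_power)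
  have less: "\<bar>a / real (Suc n)\<bar> < 1" for n
  proof -
    have "\<bar>a\<bar> / real (Suc n) \<le> \<bar>a\<bar> / 1" by (intro divide_left_mono) auto
    thus ?thesis using a by (simp add: abs_divide)
  qed
  have pow: "1 / real (Suc n) ^ (2 * s + 2) \<le> 1 / real (Suc n) ^ 2" for n s
    by (intro divide_left_mono power_increasing) auto
  have lim: "(\<lambda>S. F n S) \<longlonglongrightarrow> w n * g (a / real (Suc n))" for n
    using sums_mult[OF b(2)[OF less[of n]], of "w n"] by (simp add: F_def sums_def)
  have bound: "norm (F n S) \<le> M n" for n S
  proof -
    have "0 \<le> F n S" unfolding F_def by (intro sum_nonneg mult_nonneg_nonneg w b even)
    moreover have "F n S \<le> (\<Sum>s<S. w n / real (Suc n) ^ 2 * (b s * a ^ (2 * s + 2)))"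
      unfolding F_def
    proof (intro sum_mono)
      fix s
      have "(w n * (b s * a ^ (2 * s + 2))) * (1 / real (Suc n) ^ (2 * s + 2)) \<le>
            (w n * (b s * a ^ (2 * s + 2))) * (1 / real (Suc n) ^ 2)"
        by (intro mult_left_mono pow mult_nonneg_nonneg w b even)
      thus "w n * (b s * (a / real (Suc n)) ^ (2 * s + 2)) \<le> w n / real (Suc n) ^ 2 * (b s * a ^ (2 * s + 2))"
        unfolding power_divide by (simp only: mult_1_right times_divide_eq_right times_divide_eq_left)
    qed
    moreover have "\<dots> \<le> M n"
    proof -
      have "(\<Sum>s<S. b s * a ^ (2 * s + 2)) \<le> (\<Sum>s. b s * a ^ (2 * s + 2))"
        by (rule sum_le_suminf[OF sums_summable[OF b(2)[OF a]] finite_lessThan mult_nonneg_nonneg[OF b(1) even]])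
      also have "\<dots> = g a" using sums_unique[OF b(2)[OF a]] by (rule sym)
      finally show ?thesis
        unfolding M_def sum_distrib_left [symmetric]
        by (rule mult_left_mono) (use w(1)[of n] in simp)
    qed
    ultimately show ?thesis by simp
  qed
  have tannery: "(\<lambda>S. \<Sum>n. F n S) \<longlonglongrightarrow> (\<Sum>n. w n * g (a / real (Suc n)))"
  proof (rule tannerys_theorem[THEN conjunct2, THEN conjunct2])
    show "\<forall>\<^sub>F (n, S) in at_top \<times>\<^sub>F sequentially. norm (F n S) \<le> M n"
      using bound by (intro always_eventually) auto
  qed (use M lim in auto)
  have summ: "summable (\<lambda>n. w n / real (Suc n) ^ (2 * s + 2))" for s
  proof (rule summable_comparison_test'[OF w(2), of 0])
    fix n
    show "norm (w n / real (Suc n) ^ (2 * s + 2)) \<le> w n / real (Suc n) ^ 2"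
      using mult_left_mono[OF pow w(1), of n n s] w(1)[of n] by simp
  qed
  have "(\<Sum>n. F n S) = (\<Sum>s<S. b s * (\<Sum>n. w n / real (Suc n) ^ (2 * s + 2)) * a ^ (2 * s + 2))" for S
  proof -
    have eq: "w n * (b s * (a / real (Suc n)) ^ (2 * s + 2)) =
        w n / real (Suc n) ^ (2 * s + 2) * (b s * a ^ (2 * s + 2))" for n s
      unfolding power_divide by simp
    have "F n = (\<lambda>S. \<Sum>s<S. w n / real (Suc n) ^ (2 * s + 2) * (b s * a ^ (2 * s + 2)))" for n
      unfolding F_def eq ..
    hence "(\<Sum>n. F n S) = (\<Sum>s<S. \<Sum>n. w n / real (Suc n) ^ (2 * s + 2) * (b s * a ^ (2 * s + 2)))"
      using summ by (simp only:) (intro suminf_sum summable_mult2)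
    thus ?thesis using summ by (simp only: suminf_mult2[symmetric]) (simp only: mult_ac)
  qed
  with tannery show "(\<lambda>s. b s * (\<Sum>n. w n / real (Suc n) ^ (2 * s + 2)) * a ^ (2 * s + 2)) sums
           (\<Sum>n. w n * g (a / real (Suc n)))"
    by (simp add: sums_def)
qed

section \<open>Power series of the kernels\<close>

lemma geometric_series_even:
  fixes x :: real
  assumes "\<bar>x\<bar> < 1"
  shows "(\<lambda>s. 1 * x ^ (2 * s + 2)) sums (x ^ 2 / (1 - x ^ 2))"
proof -
  have "norm (x ^ 2) < 1" using assms by (simp add: abs_square_less_1)
  from sums_mult[OF geometric_sums[OF this], of "x ^ 2"]
  have "(\<lambda>s. x ^ 2 * (x ^ 2) ^ s) sums (x ^ 2 / (1 - x ^ 2))" by simp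
  moreover have "x ^ 2 * (x ^ 2) ^ s = 1 * x ^ (2 * s + 2)" for s
    unfolding power_mult [symmetric] power_add [symmetric] by (simp only: mult_1 add.commute)
  ultimately show ?thesis by (simp only:)
qed

lemma neg_binomial_series:
  fixes x :: real
  assumes "\<bar>x\<bar> < 1" "i \<ge> 1"
  shows "(\<lambda>r. real ((i - 1 + r) choose r) * x ^ r) sums (1 / (1 - x) ^ i)"
proof -
  have "(\<lambda>r. ((- real i) gchoose r) * (- x) ^ r) sums (1 + (- x)) powr (- real i)"
    using assms by (intro gen_binomial_real) auto
  moreover have "((- real i) gchoose r) * (- x) ^ r = real ((i - 1 + r) choose r) * x ^ r" for r
  proof -
    have "((- real i) gchoose r) = (-1) ^ r * real ((i - 1 + r) choose r)"
      using assms(2) by (simp add: gbinomial_minus binomial_gbinomial of_nat_diff algebra_simps)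
    thus ?thesis by (simp add: power_minus[of x] mult_ac)
  qed
  moreover have "(1 + (- x)) powr (- real i) = 1 / (1 - x) ^ i"
    using assms by (simp add: powr_minus powr_realpow inverse_eq_divide)
  ultimately show ?thesis by simp
qed

lemma sums_pairs: "f sums (l::real) \<Longrightarrow> (\<lambda>n. f (2 * n) + f (2 * n + 1)) sums l"
proof -
  assume "f sums l"
  hence "(\<lambda>n. sum f {n * 2..<n * 2 + 2}) sums l" by (rule sums_group) simp
  moreover have "{n * 2..<n * 2 + 2} = {2 * n, 2 * n + 1}" for n :: nat by auto
  ultimately show ?thesis by (simp add: mult.commute)
qed

text \<open>Adding the series at \<open>x\<close> and \<open>- x\<close> keeps the even powers. The
  constant term 2 is removed so that exponents start at 2, the shape of
  \<open>even_series_exchange\<close>.\<close>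

lemma neg_binomial_even_part:
  fixes x :: real
  assumes "\<bar>x\<bar> < 1" "i \<ge> 1"
  shows "(\<lambda>s. 2 * real ((i + 2 * s + 1) choose (2 * s + 2)) * x ^ (2 * s + 2)) sums
           (1 / (1 - x) ^ i + 1 / (1 + x) ^ i - 2)"
proof -
  define c where "c = (\<lambda>r. real ((i - 1 + r) choose r))"
  have "(\<lambda>r. c r * x ^ r + c r * (- x) ^ r) sums (1 / (1 - x) ^ i + 1 / (1 - (- x)) ^ i)"
    unfolding c_def using assms by (intro sums_add neg_binomial_series) auto
  from sums_pairs[OF this] have "(\<lambda>s. 2 * c (2 * s) * x ^ (2 * s)) sums (1 / (1 - x) ^ i + 1 / (1 + x) ^ i)"
    by (simp add: algebra_simps)
  hence "(\<lambda>s. 2 * c (2 * Suc s) * x ^ (2 * Suc s)) sums (1 / (1 - x) ^ i + 1 / (1 + x) ^ i - 2)"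
    by (subst sums_Suc_iff) (simp add: c_def)
  thus ?thesis using assms(2) by (simp add: c_def)
qed

text \<open>The extra factor \<open>x\<close> lifts the odd exponents to \<open>2 * s + 2\<close>,
  again the shape of \<open>even_series_exchange\<close>.\<close>

lemma neg_binomial_odd_part:
  fixes x :: real
  assumes "\<bar>x\<bar> < 1" "i \<ge> 1"
  shows "(\<lambda>s. 2 * real ((i + 2 * s) choose (2 * s + 1)) * x ^ (2 * s + 2)) sums
           (x * (1 / (1 - x) ^ i - 1 / (1 + x) ^ i))"
proof -
  define c where "c = (\<lambda>r. real ((i - 1 + r) choose r))"
  have "(\<lambda>r. c r * x ^ r - c r * (- x) ^ r) sums (1 / (1 - x) ^ i - 1 / (1 - (- x)) ^ i)"
    unfolding c_def using assms by (intro sums_diff neg_binomial_series) auto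
  from sums_mult[OF sums_pairs[OF this], of x]
  have "(\<lambda>s. 2 * c (2 * s + 1) * x ^ (2 * s + 2)) sums (x * (1 / (1 - x) ^ i - 1 / (1 + x) ^ i))"
    by (simp add: algebra_simps)
  thus ?thesis using assms(2) by (simp add: c_def)
qed

text \<open>Positive arguments suffice, which fits the later substitution \<open>y = a ^ 2\<close>.
  Once the lower coefficients vanish, divide by \<open>y ^ n\<close> and let \<open>y\<close> tend
  to 0 from the right.\<close>

lemma power_series_eq_0:
  fixes c :: "nat \<Rightarrow> real"
  assumes "\<And>y. 0 < y \<Longrightarrow> y < 1 \<Longrightarrow> (\<lambda>n. c n * y ^ n) sums 0"
  shows "c n = 0"
proof (induction n rule: less_induct)
  case (less n)
  have sums: "(\<lambda>r. c (r + n) * y ^ r) sums 0" if "0 < y" "y < 1" for y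
  proof -
    have "(\<lambda>r. c (r + n) * y ^ (r + n)) sums (0 - (\<Sum>i<n. c i * y ^ i))"
      using assms[OF that] by (subst sums_iff_shift) simp
    hence "(\<lambda>r. (c (r + n) * y ^ r) * y ^ n) sums 0"
      using less by (simp add: power_add mult_ac)
    from sums_mult2[OF this, of "1 / y ^ n"] show ?thesis using that by simp
  qed
  define f where "f = (\<lambda>y. \<Sum>r. c (r + n) * y ^ r)"
  \<comment> \<open>Convergence at the single point \<open>1/2\<close> yields convergence on a disc
    around 0, hence the limit of \<open>f\<close> at 0.\<close>
  have "summable (\<lambda>r. c (r + n) * (1/2) ^ r)"
    using sums[of "1/2"] by (intro sums_summable[where l = 0]) simp
  hence "summable (\<lambda>r. c (r + n) * y ^ r)" if "norm y < 1/2" for y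
  proof -
    from that have "norm y < norm (1/2 :: real)" by simp
    with \<open>summable (\<lambda>r. c (r + n) * (1/2) ^ r)\<close> show ?thesis by (rule powser_inside)
  qed
  hence "(f \<longlongrightarrow> c (0 + n)) (at 0)"
    unfolding f_def by (intro powser_limit_0[of "1/2"] summable_sums) auto
  hence "(f \<longlongrightarrow> c n) (at_right 0)"
    by (simp add: filterlim_at_split)
  moreover have "eventually (\<lambda>y. f y = 0) (at_right 0)"
  proof -
    have "eventually (\<lambda>y. y \<in> {0<..<1}) (at_right (0::real))"
      by (rule eventually_at_right_real) simp
    thus ?thesis
      by eventually_elim (use sums in \<open>auto simp: f_def sums_iff\<close>)
  qed
  ultimately have "((\<lambda>_. 0) \<longlongrightarrow> c n) (at_right (0::real))"
    by (rule Lim_transform_eventually)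
  thus ?case by (simp add: tendsto_const_iff)
qed

section \<open>Expansions with zeta values as coefficients\<close>

lemma zeta_nonneg: "k \<ge> 1 \<Longrightarrow> zeta k \<ge> 0"
  by (cases "k = 1") (auto simp: zeta_def simp del: of_nat_Suc intro!: suminf_nonneg summable_inverse_power)

lemma sums_zeta: "k \<ge> 2 \<Longrightarrow> (\<lambda>n. 1 / real (Suc n) ^ k) sums zeta k"
  using summable_sums[OF summable_inverse_power[of k]] by (simp add: zeta_def)

lemma scaled_even_square:
  fixes a :: real
  shows "(a / real (Suc n)) ^ 2 / (1 - (a / real (Suc n)) ^ 2) = a ^ 2 / (real (Suc n) ^ 2 - a ^ 2)"
proof -
  have "1 - (a / real (Suc n)) ^ 2 = (real (Suc n) ^ 2 - a ^ 2) / real (Suc n) ^ 2"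
    by (simp add: power_divide diff_divide_distrib del: of_nat_Suc)
  thus ?thesis by (simp add: power_divide del: of_nat_Suc)
qed

text \<open>A geometric series for each pair of poles gives the terms with \<open>k \<ge> 1\<close>.
  The pole at 0 gives the constant 1, which is \<open>- 2 * zeta 0\<close>.\<close>

lemma pi_cot_power_series:
  fixes a :: real
  assumes "0 < a" "a < 1"
  shows "(\<lambda>k. - 2 * zeta (2 * k) * a ^ (2 * k)) sums (a * (pi * cot (pi * a)))"
proof -
  have a: "a \<notin> \<int>" using assms by (auto elim!: Ints_cases)
  have "(\<lambda>s. 1 * (\<Sum>n. 1 / real (Suc n) ^ (2 * s + 2)) * a ^ (2 * s + 2)) sums
           (\<Sum>n. 1 * ((a / real (Suc n)) ^ 2 / (1 - (a / real (Suc n)) ^ 2)))"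
    using assms summable_inverse_power[of 2]
    by (intro even_series_exchange[where w = "\<lambda>_. 1" and b = "\<lambda>_. 1" and g = "\<lambda>x. x ^ 2 / (1 - x ^ 2)"]
        geometric_series_even) auto
  hence 1: "(\<lambda>s. zeta (2 * s + 2) * a ^ (2 * s + 2)) sums (\<Sum>n. a ^ 2 / (real (Suc n) ^ 2 - a ^ 2))"
    unfolding scaled_even_square by (simp add: zeta_def)
  have "(\<lambda>N. (\<Sum>n=-int N..int N. 1 / (a - of_int n)) - 1 / a) \<longlonglongrightarrow> pi * cot (pi * a) - 1 / a"
    by (intro tendsto_diff cot_partial_fractions a tendsto_const)
  hence "(\<lambda>n. 1 / (a - real (Suc n)) + 1 / (a + real (Suc n))) sums (pi * cot (pi * a) - 1 / a)"
    unfolding sums_def sum_symmetric_int of_int_minus of_int_of_nat_eq diff_minus_eq_add by simp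
  hence "(\<lambda>n. (1 / (a - real (Suc n)) + 1 / (a + real (Suc n))) * (- a / 2)) sums
      ((pi * cot (pi * a) - 1 / a) * (- a / 2))"
    by (rule sums_mult2)
  moreover have "(1 / (a - real (Suc n)) + 1 / (a + real (Suc n))) * (- a / 2) =
      a ^ 2 / (real (Suc n) ^ 2 - a ^ 2)" for n
  proof -
    have "a - real (Suc n) \<noteq> 0" "a + real (Suc n) \<noteq> 0" using assms by auto
    moreover have "real (Suc n) ^ 2 - a ^ 2 = - ((a - real (Suc n)) * (a + real (Suc n)))"
      by (simp add: algebra_simps power2_eq_square)
    ultimately show ?thesis by (simp add: add_frac_eq power2_eq_square del: of_nat_Suc)
  qed
  ultimately have "(\<lambda>n. a ^ 2 / (real (Suc n) ^ 2 - a ^ 2)) sums ((pi * cot (pi * a) - 1 / a) * (- a / 2))"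
    by (simp only:)
  with 1 have "(\<lambda>s. zeta (2 * s + 2) * a ^ (2 * s + 2)) sums ((pi * cot (pi * a) - 1 / a) * (- a / 2))"
    by (simp only: sums_unique[symmetric])
  hence "(\<lambda>s. - 2 * (zeta (2 * s + 2) * a ^ (2 * s + 2))) sums (- 2 * ((pi * cot (pi * a) - 1 / a) * (- a / 2)))"
    by (rule sums_mult)
  also have "- 2 * ((pi * cot (pi * a) - 1 / a) * (- a / 2)) = a * (pi * cot (pi * a)) - 1"
    using assms by (simp add: algebra_simps)
  finally have "(\<lambda>k. - 2 * zeta (2 * Suc k) * a ^ (2 * Suc k)) sums (a * (pi * cot (pi * a)) - 1)"
    by (simp only: mult_Suc_right add.commute mult.assoc)
  thus ?thesis by (subst (asm) sums_Suc_iff) (simp add: zeta_def)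
qed

text \<open>Rescales \<open>neg_binomial_even_part\<close> to \<open>a / Suc n\<close> with weight
  \<open>1 / real (Suc n) ^ i\<close>.\<close>

lemma recip_second_diff_power_series:
  fixes a :: real
  assumes "\<bar>a\<bar> < 1" "i \<ge> 1"
  shows "(\<lambda>s. 2 * real ((i + 2 * s + 1) choose (2 * s + 2)) * zeta (i + 2 * s + 2) * a ^ (2 * s + 2)) sums
    (\<Sum>j. 1 / (real (Suc j) - a) ^ i + 1 / (real (Suc j) + a) ^ i - 2 / real (Suc j) ^ i)"
proof -
  have "(\<lambda>s. 2 * real ((i + 2 * s + 1) choose (2 * s + 2)) *
      (\<Sum>n. 1 / real (Suc n) ^ i / real (Suc n) ^ (2 * s + 2)) * a ^ (2 * s + 2)) sums
    (\<Sum>n. 1 / real (Suc n) ^ i * (1 / (1 - a / real (Suc n)) ^ i + 1 / (1 + a / real (Suc n)) ^ i - 2))"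
  proof (rule even_series_exchange[OF _ _ _ neg_binomial_even_part])
    show "summable (\<lambda>n. 1 / real (Suc n) ^ i / real (Suc n) ^ 2)"
      using summable_inverse_power[of "i + 2"] by (simp only: power_add divide_divide_eq_left)
  qed (use assms in auto)
  moreover have "(\<Sum>n. 1 / real (Suc n) ^ i / real (Suc n) ^ (2 * s + 2)) = zeta (i + 2 * s + 2)" for s
    using sums_unique[OF sums_zeta[of "i + 2 * s + 2"]]
    by (simp add: power_add mult_ac)
  moreover have "1 / real (Suc n) ^ i * (1 / (1 - a / real (Suc n)) ^ i + 1 / (1 + a / real (Suc n)) ^ i - 2) =
     1 / (real (Suc n) - a) ^ i + 1 / (real (Suc n) + a) ^ i - 2 / real (Suc n) ^ i" for n
  proof -
    have "1 / real (Suc n) ^ i * (1 / (1 - a / real (Suc n)) ^ i) = 1 / (real (Suc n) - a) ^ i"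
      "1 / real (Suc n) ^ i * (1 / (1 + a / real (Suc n)) ^ i) = 1 / (real (Suc n) + a) ^ i"
      by (simp_all add: power_mult_distrib [symmetric] algebra_simps del: of_nat_Suc)
    thus ?thesis by (simp only: distrib_left right_diff_distrib)
  qed
  ultimately show ?thesis by (simp only:)
qed

text \<open>The weight has exponent \<open>i - 1\<close> only, because the factor
  \<open>x = a / Suc n\<close> in \<open>neg_binomial_odd_part\<close> supplies the remaining
  power.\<close>

lemma recip_diff_power_series:
  fixes a :: real
  assumes "\<bar>a\<bar> < 1" "i \<ge> 1"
  shows "(\<lambda>s. 2 * real ((i + 2 * s) choose (2 * s + 1)) * zeta (i + 2 * s + 1) * a ^ (2 * s + 2)) sums
    (a * (\<Sum>j. 1 / (real (Suc j) - a) ^ i - 1 / (real (Suc j) + a) ^ i))"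
proof -
  have "(\<lambda>s. 2 * real ((i + 2 * s) choose (2 * s + 1)) *
      (\<Sum>n. 1 / real (Suc n) ^ (i - 1) / real (Suc n) ^ (2 * s + 2)) * a ^ (2 * s + 2)) sums
    (\<Sum>n. 1 / real (Suc n) ^ (i - 1) *
      (a / real (Suc n) * (1 / (1 - a / real (Suc n)) ^ i - 1 / (1 + a / real (Suc n)) ^ i)))"
  proof (rule even_series_exchange[OF _ _ _ neg_binomial_odd_part])
    show "summable (\<lambda>n. 1 / real (Suc n) ^ (i - 1) / real (Suc n) ^ 2)"
      using summable_inverse_power[of "(i - 1) + 2"] by (simp only: power_add divide_divide_eq_left)
  qed (use assms in auto)
  moreover have "(\<Sum>n. 1 / real (Suc n) ^ (i - 1) / real (Suc n) ^ (2 * s + 2)) = zeta (i + 2 * s + 1)" for s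
  proof -
    have "i + 2 * s + 1 = (i - 1) + (2 * s + 2)" using assms by simp
    thus ?thesis using sums_unique[OF sums_zeta[of "i + 2 * s + 1"]] assms
      by (simp only: power_add) simp
  qed
  moreover have "1 / real (Suc n) ^ (i - 1) *
      (a / real (Suc n) * (1 / (1 - a / real (Suc n)) ^ i - 1 / (1 + a / real (Suc n)) ^ i)) =
     a * (1 / (real (Suc n) - a) ^ i - 1 / (real (Suc n) + a) ^ i)" for n
  proof -
    have "real (Suc n) ^ i = real (Suc n) ^ (i - 1) * real (Suc n)"
      using assms by (cases i) auto
    hence "1 / real (Suc n) ^ (i - 1) * (a / real (Suc n) * X) = a * (1 / real (Suc n) ^ i * X)" for X
      by simp
    moreover have "1 / real (Suc n) ^ i * (1 / (1 - a / real (Suc n)) ^ i) = 1 / (real (Suc n) - a) ^ i"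
      "1 / real (Suc n) ^ i * (1 / (1 + a / real (Suc n)) ^ i) = 1 / (real (Suc n) + a) ^ i"
      by (simp_all add: power_mult_distrib [symmetric] algebra_simps del: of_nat_Suc)
    ultimately show ?thesis by (simp only: right_diff_distrib)
  qed
  moreover have "(\<Sum>n. a * (1 / (real (Suc n) - a) ^ i - 1 / (real (Suc n) + a) ^ i)) =
      a * (\<Sum>n. 1 / (real (Suc n) - a) ^ i - 1 / (real (Suc n) + a) ^ i)"
    by (intro suminf_mult bigo_inverse_square_imp_summable recip_diff_bigo assms)
  ultimately show ?thesis by (simp only:)
qed

text \<open>Compares coefficients in \<open>harmonic_pair_sums\<close>, multiplied by
  \<open>a\<close>. The first sum is the Cauchy product of the cotangent series with the second
  differences, the other one comes from the series of \<open>g\<close>.\<close>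

lemma euler_sum_odd_even:
  fixes m s :: nat
  defines "p \<equiv> 2 * m + 1"
  shows "(\<lambda>n. gen_harmonic (Suc n) p / real (Suc n) ^ (2 * s + 2)) sums
     (zeta (p + 2 * s + 2) / 2
      - (\<Sum>k\<le>s. zeta (2 * k) * real ((p + 2 * (s - k) + 1) choose (2 * (s - k) + 2)) * zeta (p + 2 * (s - k) + 2))
      - (\<Sum>k=0..m. zeta (2 * k) * real ((2 * m - 2 * k + 2 + 2 * s) choose (2 * s + 1)) * zeta (2 * m - 2 * k + 2 + 2 * s + 1)))"
proof -
  have p: "p \<ge> 1" by (simp add: p_def)
  define W where "W = (\<lambda>n. gen_harmonic n p + gen_harmonic (Suc n) p)"
  define Wz where "Wz = (\<lambda>s. \<Sum>n. W n / real (Suc n) ^ (2 * s + 2))"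
  define d where "d = (\<lambda>s. 2 * real ((p + 2 * s + 1) choose (2 * s + 2)) * zeta (p + 2 * s + 2))"
  define e where "e = (\<lambda>k s. 2 * real ((2 * m - 2 * k + 2 + 2 * s) choose (2 * s + 1)) * zeta (2 * m - 2 * k + 2 + 2 * s + 1))"
  have W_nonneg: "W n \<ge> 0" for n by (simp add: W_def gen_harmonic_nonneg)
  have W_summable: "summable (\<lambda>n. W n / real (Suc n) ^ r)" if "r \<ge> 2" for r
  proof (rule summable_comparison_test'[where N = 0])
    have "(\<lambda>j. 1 / (real (Suc j) + 0) ^ r) \<in> O(\<lambda>j. 1 / real j ^ 2)"
      using that by (rule recip_power_bigo)
    thus "summable (\<lambda>n. 4 * (sqrt (real (Suc n)) * \<bar>1 / (real (Suc n) + 0) ^ r\<bar>))"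
      by (intro summable_mult summable_sqrt_mult)
    fix n
    have "W n \<le> 4 * sqrt (real (Suc n))"
      using gen_harmonic_mono[of n "Suc n" p] gen_harmonic_le_sqrt[OF p, of "Suc n"] by (simp add: W_def)
    hence "W n / real (Suc n) ^ r \<le> 4 * sqrt (real (Suc n)) / real (Suc n) ^ r"
      by (rule divide_right_mono) simp
    thus "norm (W n / real (Suc n) ^ r) \<le> 4 * (sqrt (real (Suc n)) * \<bar>1 / (real (Suc n) + 0) ^ r\<bar>)"
      using W_nonneg[of n] by simp
  qed
  \<comment> \<open>The coefficient of \<open>a ^ (2 * s + 2)\<close> after moving all terms to one
    side.\<close>
  define c where "c = (\<lambda>s. 2 * Wz s + (\<Sum>k\<le>s. 2 * zeta (2 * k) * d (s - k)) + (\<Sum>k=0..m. 2 * zeta (2 * k) * e k s))"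
  have "c s = 0"
  proof (rule power_series_eq_0)
    fix y :: real assume y: "0 < y" "y < 1"
    define a where "a = sqrt y"
    have a: "0 < a" "a < 1" "a ^ 2 = y" using y by (auto simp: a_def real_sqrt_lt_1_iff)
    hence a': "\<bar>a\<bar> < 1" "a \<notin> \<int>" by (auto elim!: Ints_cases)
    define U where "U = (\<Sum>j. 1 / (real (Suc j) - a) ^ p + 1 / (real (Suc j) + a) ^ p - 2 / real (Suc j) ^ p)"
    define G where "G = (\<lambda>i. \<Sum>j. 1 / (real (Suc j) - a) ^ i - 1 / (real (Suc j) + a) ^ i)"
    have "(\<lambda>s. 1 * Wz s * a ^ (2 * s + 2)) sums
           (\<Sum>n. W n * ((a / real (Suc n)) ^ 2 / (1 - (a / real (Suc n)) ^ 2)))"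
      unfolding Wz_def using a' W_nonneg W_summable
      by (intro even_series_exchange[where g = "\<lambda>x. x ^ 2 / (1 - x ^ 2)"] geometric_series_even) auto
    hence 1: "(\<lambda>s. Wz s * a ^ (2 * s + 2)) sums (\<Sum>n. W n * (a ^ 2 / (real (Suc n) ^ 2 - a ^ 2)))"
      unfolding scaled_even_square mult_1 .
    have "(\<lambda>n. W n * (2 * a / (real (Suc n) ^ 2 - a ^ 2)) * (a / 2)) sums
       ((pi * cot (pi * a) * U - 2 * (\<Sum>k=0..m. zeta (2 * k) * G (2 * m - 2 * k + 2))) * (a / 2))"
      unfolding W_def U_def G_def p_def by (intro sums_mult2 harmonic_pair_sums a')
    moreover have "W n * (2 * a / (real (Suc n) ^ 2 - a ^ 2)) * (a / 2) = W n * (a ^ 2 / (real (Suc n) ^ 2 - a ^ 2))" for n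
    proof -
      have "x * (2 * a / q) * (a / 2) = x * (a ^ 2 / q)" for x q :: real
        by (simp add: power2_eq_square)
      thus ?thesis .
    qed
    ultimately have "(\<Sum>n. W n * (a ^ 2 / (real (Suc n) ^ 2 - a ^ 2))) =
       (pi * cot (pi * a) * U - 2 * (\<Sum>k=0..m. zeta (2 * k) * G (2 * m - 2 * k + 2))) * (a / 2)"
      by (simp only: sums_unique[symmetric])
    hence 2: "2 * (\<Sum>n. W n * (a ^ 2 / (real (Suc n) ^ 2 - a ^ 2))) =
       a * (pi * cot (pi * a)) * U - (\<Sum>k=0..m. 2 * zeta (2 * k) * (a * G (2 * m - 2 * k + 2)))"
      by (simp add: algebra_simps sum_distrib_left)
    have C: "(\<lambda>k. - 2 * zeta (2 * k) * a ^ (2 * k)) sums (a * (pi * cot (pi * a)))"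
      using a by (intro pi_cot_power_series)
    have D: "(\<lambda>s. d s * a ^ (2 * s + 2)) sums U"
      unfolding d_def U_def by (intro recip_second_diff_power_series a' p)
    \<comment> \<open>The Cauchy product needs absolute convergence. Apart from the term
      \<open>k = 0\<close>, which is 1, all terms are nonpositive, so dropping it leaves a series of
      one sign.\<close>
    have "summable (\<lambda>k. norm (- 2 * zeta (2 * k) * a ^ (2 * k)))"
    proof (subst summable_Suc_iff [symmetric])
      have "summable (\<lambda>k. - (- 2 * zeta (2 * Suc k) * a ^ (2 * Suc k)))"
        using sums_summable[OF C] by (intro summable_minus) (simp only: summable_Suc_iff[of "\<lambda>k. - 2 * zeta (2 * k) * a ^ (2 * k)"])
      moreover have "norm (- 2 * zeta (2 * Suc k) * a ^ (2 * Suc k)) = - (- 2 * zeta (2 * Suc k) * a ^ (2 * Suc k))" for k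
        using zeta_nonneg[of "2 * Suc k"] a by (simp add: abs_mult)
      ultimately show "summable (\<lambda>k. norm (- 2 * zeta (2 * Suc k) * a ^ (2 * Suc k)))" by (simp only:)
    qed
    moreover have "summable (\<lambda>s. norm (d s * a ^ (2 * s + 2)))"
    proof -
      have "norm (d s * a ^ (2 * s + 2)) = d s * a ^ (2 * s + 2)" for s
        using zeta_nonneg[of "p + 2 * s + 2"] a by (simp add: d_def abs_mult)
      thus ?thesis using sums_summable[OF D] by (simp only:)
    qed
    ultimately have "(\<lambda>s. \<Sum>k\<le>s. (- 2 * zeta (2 * k) * a ^ (2 * k)) * (d (s - k) * a ^ (2 * (s - k) + 2))) sums
       ((\<Sum>k. - 2 * zeta (2 * k) * a ^ (2 * k)) * (\<Sum>s. d s * a ^ (2 * s + 2)))"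
      by (rule Cauchy_product_sums)
    moreover have "(\<Sum>k\<le>s. (- 2 * zeta (2 * k) * a ^ (2 * k)) * (d (s - k) * a ^ (2 * (s - k) + 2))) =
        - (\<Sum>k\<le>s. 2 * zeta (2 * k) * d (s - k)) * a ^ (2 * s + 2)" for s
    proof -
      have "(- 2 * zeta (2 * k) * a ^ (2 * k)) * (d (s - k) * a ^ (2 * (s - k) + 2)) =
         - (2 * zeta (2 * k) * d (s - k) * a ^ (2 * s + 2))" if "k \<le> s" for k
      proof -
        have "2 * s + 2 = 2 * k + (2 * (s - k) + 2)" using that by simp
        hence "a ^ (2 * s + 2) = a ^ (2 * k) * a ^ (2 * (s - k) + 2)" by (metis power_add)
        moreover have "(- 2 * z * x) * (b * y) = - (2 * z * b * (x * y))" for b x y z :: real by simp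
        ultimately show ?thesis by (simp only:)
      qed
      hence "(\<Sum>k\<le>s. (- 2 * zeta (2 * k) * a ^ (2 * k)) * (d (s - k) * a ^ (2 * (s - k) + 2))) =
        (\<Sum>k\<le>s. - (2 * zeta (2 * k) * d (s - k) * a ^ (2 * s + 2)))"
        by (intro sum.cong) auto
      thus ?thesis by (simp only: sum_negf sum_distrib_right mult_minus_left)
    qed
    ultimately have 3: "(\<lambda>s. - (\<Sum>k\<le>s. 2 * zeta (2 * k) * d (s - k)) * a ^ (2 * s + 2)) sums
       (a * (pi * cot (pi * a)) * U)"
      by (simp only: sums_unique[OF C, symmetric] sums_unique[OF D, symmetric])
    have 4: "(\<lambda>s. \<Sum>k=0..m. 2 * zeta (2 * k) * (e k s * a ^ (2 * s + 2))) sums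
       (\<Sum>k=0..m. 2 * zeta (2 * k) * (a * G (2 * m - 2 * k + 2)))"
      unfolding e_def G_def by (intro sums_sum sums_mult recip_diff_power_series a') simp
    have "(\<lambda>s. 2 * (Wz s * a ^ (2 * s + 2)) - (- (\<Sum>k\<le>s. 2 * zeta (2 * k) * d (s - k)) * a ^ (2 * s + 2))
       + (\<Sum>k=0..m. 2 * zeta (2 * k) * (e k s * a ^ (2 * s + 2)))) sums
       (2 * (\<Sum>n. W n * (a ^ 2 / (real (Suc n) ^ 2 - a ^ 2))) - a * (pi * cot (pi * a)) * U
        + (\<Sum>k=0..m. 2 * zeta (2 * k) * (a * G (2 * m - 2 * k + 2))))"
      by (intro sums_add sums_diff sums_mult 1 3 4)
    hence "(\<lambda>s. (2 * Wz s + (\<Sum>k\<le>s. 2 * zeta (2 * k) * d (s - k)) + (\<Sum>k=0..m. 2 * zeta (2 * k) * e k s))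
       * a ^ (2 * s + 2)) sums 0"
      unfolding 2 by (simp add: distrib_right sum_distrib_right mult.assoc)
    moreover have "a ^ (2 * s + 2) = y ^ s * y" for s
      by (simp only: power_add power_mult a(3))
    ultimately have "(\<lambda>s. c s * y ^ s * y) sums 0"
      by (simp only: c_def mult.assoc)
    from sums_mult2[OF this, of "1 / y"] y
    show "(\<lambda>s. c s * y ^ s) sums 0" by simp
  qed
  hence Wz: "Wz s = - (\<Sum>k\<le>s. zeta (2 * k) * d (s - k)) - (\<Sum>k=0..m. zeta (2 * k) * e k s)"
    by (simp add: c_def mult.assoc flip: sum_distrib_left)
  have "(\<lambda>n. W n / real (Suc n) ^ (2 * s + 2)) sums Wz s"
    unfolding Wz_def by (intro summable_sums W_summable) simp
  \<comment> \<open>\<open>gen_harmonic (Suc n) p\<close> is half of \<open>W n\<close> plus half of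
    \<open>1 / real (Suc n) ^ p\<close>; the latter produces the isolated zeta value.\<close>
  from sums_mult[OF sums_add[OF this sums_zeta[of "p + 2 * s + 2"]], of "1/2"]
  have "(\<lambda>n. 1/2 * (W n / real (Suc n) ^ (2 * s + 2) + 1 / real (Suc n) ^ (p + 2 * s + 2))) sums
      (1/2 * (Wz s + zeta (p + 2 * s + 2)))" by simp
  moreover have "1/2 * (W n / real (Suc n) ^ (2 * s + 2) + 1 / real (Suc n) ^ (p + 2 * s + 2)) =
      gen_harmonic (Suc n) p / real (Suc n) ^ (2 * s + 2)" for n
  proof -
    have "1/2 * ((h + (h + 1 / x)) / y + 1 / (x * y)) = (h + 1 / x) / y" for h x y :: real
      by (simp add: add_divide_distrib)
    thus ?thesis by (simp only: W_def gen_harmonic_Suc add.assoc[of p] power_add[of _ p])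
  qed
  moreover have "1/2 * (Wz s + zeta (p + 2 * s + 2)) = zeta (p + 2 * s + 2) / 2
      - (\<Sum>k\<le>s. zeta (2 * k) * real ((p + 2 * (s - k) + 1) choose (2 * (s - k) + 2)) * zeta (p + 2 * (s - k) + 2))
      - (\<Sum>k=0..m. zeta (2 * k) * real ((2 * m - 2 * k + 2 + 2 * s) choose (2 * s + 1)) * zeta (2 * m - 2 * k + 2 + 2 * s + 1))"
  proof -
    have sums: "(\<Sum>k\<le>s. zeta (2 * k) * d (s - k)) = 2 * (\<Sum>k\<le>s. zeta (2 * k) *
        real ((p + 2 * (s - k) + 1) choose (2 * (s - k) + 2)) * zeta (p + 2 * (s - k) + 2))"
      "(\<Sum>k=0..m. zeta (2 * k) * e k s) = 2 * (\<Sum>k=0..m. zeta (2 * k) *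
        real ((2 * m - 2 * k + 2 + 2 * s) choose (2 * s + 1)) * zeta (2 * m - 2 * k + 2 + 2 * s + 1))"
      unfolding sum_distrib_left by (intro sum.cong refl; simp only: d_def e_def mult_ac)+
    have "1/2 * (- (2 * x) - 2 * y + z) = z / 2 - x - y" for x y z :: real by simp
    thus ?thesis unfolding Wz sums .
  qed
  ultimately show ?thesis by (simp only:)
qed

section \<open>The parametric sums\<close>

lemma summable_recip_square_minus:
  fixes a :: real
  shows "summable (\<lambda>n. 1 / (real (Suc n) ^ r * (real (Suc n) ^ 2 - a ^ 2)))"
proof -
  have "(\<lambda>n. 1 / real (Suc n)) \<in> O(\<lambda>_. 1)" by real_asymp
  hence "(\<lambda>n. (1 / real (Suc n)) ^ r) \<in> O(\<lambda>_. 1 ^ r)" by (rule landau_o.big_power)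
  moreover have "(\<lambda>n. 1 / (real (Suc n) ^ 2 - a ^ 2)) \<in> O(\<lambda>n. 1 / real n ^ 2)" by real_asymp
  ultimately have "(\<lambda>n. (1 / real (Suc n)) ^ r * (1 / (real (Suc n) ^ 2 - a ^ 2))) \<in> O(\<lambda>n. 1 ^ r * (1 / real n ^ 2))"
    by (rule landau_o.big.mult)
  thus ?thesis
    by (intro bigo_inverse_square_imp_summable) (simp add: power_divide del: of_nat_Suc)
qed

lemma power_drop_two: "(n::nat) = l + 2 \<Longrightarrow> x / a ^ n = x / a ^ l / (a::real) ^ 2"
  by (simp add: power_add power2_eq_square)

text \<open>The case \<open>s = 0\<close> of the theorem: \<open>harmonic_pair_sums\<close> divided
  by \<open>4 * a\<close>, plus half of the last term of each harmonic number.\<close>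

lemma harmonic_quadratic_sums_base:
  fixes m :: nat and a :: real
  assumes a: "a \<notin> \<int>"
  defines "p \<equiv> 2 * m + 1"
  shows "(\<lambda>n. gen_harmonic (Suc n) p / (real (Suc n) ^ 2 - a ^ 2)) sums
    (1/2 * (\<Sum>n. 1 / (real (Suc n) ^ p * (real (Suc n) ^ 2 - a ^ 2)))
     + pi * cot (pi * a) / (4 * a) * (\<Sum>n. 1 / (real (Suc n) - a) ^ p + 1 / (real (Suc n) + a) ^ p - 2 / real (Suc n) ^ p)
     - 1 / (2 * a) * (\<Sum>k=0..m. zeta (2 * k) *
         (\<Sum>n. 1 / (real (Suc n) - a) ^ (2 * m - 2 * k + 2) - 1 / (real (Suc n) + a) ^ (2 * m - 2 * k + 2))))"
    (is "_ sums (1/2 * ?X + pi * cot (pi * a) / (4 * a) * ?U - 1 / (2 * a) * ?V)")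
proof -
  have "a \<noteq> 0" using a by auto
  have "(\<lambda>n. 1/2 * (1 / (real (Suc n) ^ p * (real (Suc n) ^ 2 - a ^ 2))) +
     1 / (4 * a) * ((gen_harmonic n p + gen_harmonic (Suc n) p) * (2 * a / (real (Suc n) ^ 2 - a ^ 2)))) sums
     (1/2 * ?X + 1 / (4 * a) * (pi * cot (pi * a) * ?U - 2 * ?V))"
    unfolding p_def
    by (intro sums_add sums_mult summable_sums summable_recip_square_minus harmonic_pair_sums a)
  moreover have "1/2 * (1 / (real (Suc n) ^ p * (real (Suc n) ^ 2 - a ^ 2))) +
     1 / (4 * a) * ((gen_harmonic n p + gen_harmonic (Suc n) p) * (2 * a / (real (Suc n) ^ 2 - a ^ 2))) =
     gen_harmonic (Suc n) p / (real (Suc n) ^ 2 - a ^ 2)" for n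
  proof -
    have "1/2 * (1 / (x * q)) + 1 / (4 * a) * ((h + (h + 1 / x)) * (2 * a / q)) = (h + 1 / x) / q" for h x q
      using \<open>a \<noteq> 0\<close> by (simp add: add_divide_distrib distrib_left distrib_right)
    thus ?thesis by (simp only: gen_harmonic_Suc)
  qed
  moreover have "1 / (4 * a) * (pi * cot (pi * a) * ?U - 2 * ?V) = pi * cot (pi * a) / (4 * a) * ?U - 1 / (2 * a) * ?V"
    using \<open>a \<noteq> 0\<close> by (simp add: right_diff_distrib diff_divide_distrib)
  ultimately show ?thesis by (simp only: add_diff_eq)
qed

text \<open>Brings the Euler sum into the shape of the increments from \<open>s\<close> to
  \<open>Suc s\<close> in the theorem. The two terms \<open>k = 0\<close> are split off with
  \<open>zeta 0 = - 1 / 2\<close>, whence the two products with factor \<open>1/2\<close>.\<close>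

lemma euler_sum_odd_even':
  fixes m s :: nat
  shows "(\<lambda>n. gen_harmonic (Suc n) (2 * m + 1) / real (Suc n) ^ (2 * s + 2)) sums
     (1/2 * zeta (2 * m + 2 * s + 3)
      + zeta (2 * m + 1) * zeta (2 * s + 2)
      - (\<Sum>k=1..s+1. real ((2 * m + 2 * k - 2) choose (2 * k - 2)) * (zeta (2 * m + 2 * k - 1) * zeta (2 * Suc s - 2 * k + 2)))
      + 1/2 * (real ((2 * m + 2 * s + 2) choose (2 * s + 2)) * zeta (2 * m + 2 * s + 3))
      + 1/2 * (zeta (2 * m + 2 * s + 3) * real ((2 * m + 2 * s + 2) choose (2 * s + 1)))
      - (\<Sum>k=1..m. zeta (2 * k) * real ((2 * m - 2 * k + 2 * Suc s) choose (2 * s + 1)) * zeta (2 * m + 2 * Suc s - 2 * k + 1)))"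
proof -
  define f where "f = (\<lambda>k. zeta (2 * k) * real ((2 * m + 1 + 2 * (s - k) + 1) choose (2 * (s - k) + 2)) * zeta (2 * m + 1 + 2 * (s - k) + 2))"
  define f' where "f' = (\<lambda>k. real ((2 * m + 2 * k - 2) choose (2 * k - 2)) * (zeta (2 * m + 2 * k - 1) * zeta (2 * Suc s - 2 * k + 2)))"
  define g where "g = (\<lambda>k. zeta (2 * k) * real ((2 * m - 2 * k + 2 + 2 * s) choose (2 * s + 1)) * zeta (2 * m - 2 * k + 2 + 2 * s + 1))"
  have "(\<Sum>k\<le>s. f k) = f 0 + (\<Sum>k=1..s. f k)"
    by (simp add: atMost_atLeast0 sum.atLeast_Suc_atMost)
  also have "(\<Sum>k=1..s. f k) = (\<Sum>k=2..s+1. f' k)"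
  \<comment> \<open>Reversing the convolution lets the odd zeta argument carry the summation
    index.\<close>
  proof (rule sum.reindex_bij_witness[of _ "\<lambda>k. s + 2 - k" "\<lambda>k. s + 2 - k"])
    fix k assume k: "k \<in> {1..s}"
    define r where "r = s - k"
    have "s + 2 - k = r + 2" "2 * Suc s - 2 * (r + 2) + 2 = 2 * k" using k by (auto simp: r_def)
    thus "f' (s + 2 - k) = f k" by (simp add: f_def f'_def r_def [symmetric])
  qed auto
  \<comment> \<open>The term \<open>k = 1\<close> is added and subtracted: it completes the inner
    sum of the theorem at \<open>n = s + 1\<close> and leaves the increment of the series multiplied
    by \<open>zeta (2 * m + 1)\<close>.\<close>
  also have "(\<Sum>k=2..s+1. f' k) = (\<Sum>k=1..s+1. f' k) - f' 1"
  proof -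
    have "(\<Sum>k=1..s+1. f' k) = f' 1 + (\<Sum>k=Suc 1..s+1. f' k)"
      by (rule sum.atLeast_Suc_atMost) simp
    thus ?thesis unfolding Suc_1 by linarith
  qed
  also have "f' 1 = zeta (2 * m + 1) * zeta (2 * s + 2)" by (simp add: f'_def)
  also have "f 0 = - (1/2 * (real ((2 * m + 2 * s + 2) choose (2 * s + 2)) * zeta (2 * m + 2 * s + 3)))"
    by (simp add: f_def zeta_def[of 0] numeral_3_eq_3)
  finally have F: "(\<Sum>k\<le>s. f k) = - (1/2 * (real ((2 * m + 2 * s + 2) choose (2 * s + 2)) * zeta (2 * m + 2 * s + 3)))
      + ((\<Sum>k=1..s+1. f' k) - zeta (2 * m + 1) * zeta (2 * s + 2))" .
  have "(\<Sum>k=0..m. g k) = g 0 + (\<Sum>k=1..m. g k)"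
    by (simp add: sum.atLeast_Suc_atMost)
  also have "g 0 = - (1/2 * (zeta (2 * m + 2 * s + 3) * real ((2 * m + 2 * s + 2) choose (2 * s + 1))))"
    by (simp add: g_def zeta_def[of 0] numeral_3_eq_3)
  also have "(\<Sum>k=1..m. g k) = (\<Sum>k=1..m. zeta (2 * k) * real ((2 * m - 2 * k + 2 * Suc s) choose (2 * s + 1)) * zeta (2 * m + 2 * Suc s - 2 * k + 1))"
  proof (intro sum.cong refl)
    fix k assume k: "k \<in> {1..m}"
    hence "2 * m - 2 * k + 2 + 2 * s = 2 * m - 2 * k + 2 * Suc s"
      "2 * m - 2 * k + 2 + 2 * s + 1 = 2 * m + 2 * Suc s - 2 * k + 1" by auto
    thus "g k = zeta (2 * k) * real ((2 * m - 2 * k + 2 * Suc s) choose (2 * s + 1)) * zeta (2 * m + 2 * Suc s - 2 * k + 1)"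
      by (simp only: g_def)
  qed
  finally have G: "(\<Sum>k=0..m. g k) = - (1/2 * (zeta (2 * m + 2 * s + 3) * real ((2 * m + 2 * s + 2) choose (2 * s + 1)))) +
     (\<Sum>k=1..m. zeta (2 * k) * real ((2 * m - 2 * k + 2 * Suc s) choose (2 * s + 1)) * zeta (2 * m + 2 * Suc s - 2 * k + 1))" .
  have z: "zeta (2 * m + 1 + 2 * s + 2) / 2 = 1/2 * zeta (2 * m + 2 * s + 3)"
    by (simp add: numeral_3_eq_3)
  have eq: "z - (- x + (S - c)) - (- y + t) = z + c - S + x + y - t" for z x y S c t :: real
    by simp
  show ?thesis
    using euler_sum_odd_even[of m s, folded f_def g_def] unfolding F G z eq f'_def .
qed

text \<open>In the induction, every \<open>s\<close>-dependent sum satisfies a recurrence that adds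
  a constant and divides by \<open>a ^ 2\<close>; the constants combine to the negated Euler sum of
  exponent \<open>2 * s + 2\<close>. The coefficient
  \<open>(2 * m + 2 * k - 2) choose (2 * k - 2)\<close> comes from the even part of
  \<open>1 / (1 - x) ^ (2 * m + 1)\<close>.\<close>

theorem theorem2p4:
  fixes m s :: nat and a :: real
  assumes "a \<notin> \<int>"
  shows "(\<lambda>n. gen_harmonic (Suc n) (2 * m+1) / (real (Suc n) ^ (2 * s) * (real (Suc n) ^ 2 - a ^ 2))) sums
    ( 1/2 * (\<Sum>n. 1 / (real (Suc n) ^ (2 * s+2 * m+1) * (real (Suc n) ^ 2 - a ^ 2)))
    + (\<Sum>n=1..s. \<Sum>k=1..n. real ((2 * m+2 * k-2) choose (2 * k-2))
          * (zeta (2 * m+2 * k-1) * zeta (2 * n-2 * k+2) / a ^ (2 * s-2 * n+2)))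
    + zeta (2 * m+1) * (\<Sum>n. 1 / (real (Suc n) ^ 2 - a ^ 2) * (1 / real (Suc n) ^ (2 * s) - 1 / a ^ (2 * s)))
    - 1/2 * (\<Sum>k=2..s+1. real ((2 * m+2 * k-2) choose (2 * k-2)) * (zeta (2 * m+2 * k-1) / a ^ (2 * s+4-2 * k)))
    + pi * cot (pi * a) / (4 * a ^ (2 * s+1))
        * (\<Sum>n. 1 / (real (Suc n) - a) ^ (2 * m+1) + 1 / (real (Suc n) + a) ^ (2 * m+1)
                - 2 / real (Suc n) ^ (2 * m+1))
    - 1/2 * (\<Sum>j=1..s. zeta (2 * m+2 * j+1) / a ^ (2 * s+2-2 * j) * real ((2 * m+2 * j) choose (2 * j-1)))
    + (\<Sum>k=1..m. \<Sum>j=1..s. zeta (2 * k) / a ^ (2 * s+2-2 * j)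
          * real ((2 * m-2 * k+2 * j) choose (2 * j-1)) * zeta (2 * m+2 * j-2 * k+1))
    - 1 / (2 * a ^ (2 * s+1)) * (\<Sum>k=0..m. zeta (2 * k)
          * (\<Sum>n. 1 / (real (Suc n) - a) ^ (2 * m-2 * k+2) - 1 / (real (Suc n) + a) ^ (2 * m-2 * k+2))))"
proof (induction s)
  case 0
  show ?case using harmonic_quadratic_sums_base[OF assms, of m] by simp
next
  case (Suc s)
  have a0: "a \<noteq> 0" using assms by auto
  have D: "real (Suc n) ^ 2 - a ^ 2 \<noteq> 0" for n
  proof
    assume "real (Suc n) ^ 2 - a ^ 2 = 0"
    hence "a = real (Suc n) \<or> a = - real (Suc n)" by (auto simp: power2_eq_iff)
    thus False using assms by (metis Ints_minus Ints_of_nat)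
  qed
  define X where "X s = (\<Sum>n. 1 / (real (Suc n) ^ (2 * s+2 * m+1) * (real (Suc n) ^ 2 - a ^ 2)))" for s
  define P where "P s = (\<Sum>n=1..s. \<Sum>k=1..n. real ((2 * m+2 * k-2) choose (2 * k-2))
          * (zeta (2 * m+2 * k-1) * zeta (2 * n-2 * k+2) / a ^ (2 * s-2 * n+2)))" for s
  define Y where "Y s = (\<Sum>n. 1 / (real (Suc n) ^ 2 - a ^ 2) * (1 / real (Suc n) ^ (2 * s) - 1 / a ^ (2 * s)))" for s
  define Q where "Q s = (\<Sum>k=2..s+1. real ((2 * m+2 * k-2) choose (2 * k-2)) * (zeta (2 * m+2 * k-1) / a ^ (2 * s+4-2 * k)))" for s
  define Q' where "Q' s = (\<Sum>j=1..s. zeta (2 * m+2 * j+1) / a ^ (2 * s+2-2 * j) * real ((2 * m+2 * j) choose (2 * j-1)))" for s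
  define P' where "P' s = (\<Sum>k=1..m. \<Sum>j=1..s. zeta (2 * k) / a ^ (2 * s+2-2 * j)
          * real ((2 * m-2 * k+2 * j) choose (2 * j-1)) * zeta (2 * m+2 * j-2 * k+1))" for s
  define U where "U = (\<Sum>n. 1 / (real (Suc n) - a) ^ (2 * m+1) + 1 / (real (Suc n) + a) ^ (2 * m+1)
                - 2 / real (Suc n) ^ (2 * m+1))"
  define V where "V = (\<Sum>k=0..m. zeta (2 * k)
          * (\<Sum>n. 1 / (real (Suc n) - a) ^ (2 * m-2 * k+2) - 1 / (real (Suc n) + a) ^ (2 * m-2 * k+2)))"
  \<comment> \<open>Each lower-case letter is the increment of the quantity with the corresponding
    capital letter.\<close>
  define p where "p = (\<Sum>k=1..s+1. real ((2 * m + 2 * k - 2) choose (2 * k - 2)) * (zeta (2 * m + 2 * k - 1) * zeta (2 * Suc s - 2 * k + 2)))"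
  define q where "q = real ((2 * m + 2 * s + 2) choose (2 * s + 2)) * zeta (2 * m + 2 * s + 3)"
  define q' where "q' = zeta (2 * m + 2 * s + 3) * real ((2 * m + 2 * s + 2) choose (2 * s + 1))"
  define p' where "p' = (\<Sum>k=1..m. zeta (2 * k) * real ((2 * m - 2 * k + 2 * Suc s) choose (2 * s + 1)) * zeta (2 * m + 2 * Suc s - 2 * k + 1))"
  note IH = Suc.IH[folded X_def P_def Y_def Q_def Q'_def P'_def U_def V_def]
  note euler = euler_sum_odd_even'[of m s, folded p_def q_def q'_def p'_def]

  have X: "X (Suc s) = (X s - zeta (2 * m + 2 * s + 3)) / a ^ 2"
  proof -
    have "(\<lambda>n. (1 / (real (Suc n) ^ (2 * s+2 * m+1) * (real (Suc n) ^ 2 - a ^ 2))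
        - 1 / real (Suc n) ^ (2 * m + 2 * s + 3)) / a ^ 2) sums ((X s - zeta (2 * m + 2 * s + 3)) / a ^ 2)"
      unfolding X_def by (intro sums_divide sums_diff summable_sums summable_recip_square_minus sums_zeta) simp
    moreover have "(1 / (real (Suc n) ^ (2 * s+2 * m+1) * (real (Suc n) ^ 2 - a ^ 2))
        - 1 / real (Suc n) ^ (2 * m + 2 * s + 3)) / a ^ 2 =
        1 / (real (Suc n) ^ (2 * Suc s+2 * m+1) * (real (Suc n) ^ 2 - a ^ 2))" for n
    proof -
      have "(1 / (u * (x ^ 2 - a ^ 2)) - 1 / (u * x ^ 2)) / a ^ 2 = 1 / (u * x ^ 2 * (x ^ 2 - a ^ 2))"
        if "x ^ 2 - a ^ 2 \<noteq> 0" "x \<noteq> 0" "u \<noteq> 0" for u x :: real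
        using that a0 by (simp add: divide_simps; simp add: algebra_simps)
      moreover have "2 * m + 2 * s + 3 = (2 * s + 2 * m + 1) + 2" "2 * Suc s + 2 * m + 1 = (2 * s + 2 * m + 1) + 2"
        by simp_all
      ultimately show ?thesis using D[of n] by (simp only: power_add; simp)
    qed
    ultimately show ?thesis unfolding X_def[of "Suc s"] by (simp only: sums_unique[symmetric])
  qed

  have Y: "Y (Suc s) = (Y s - zeta (2 * s + 2)) / a ^ 2"
  proof -
    have summ: "summable (\<lambda>n. 1 / (real (Suc n) ^ 2 - a ^ 2) * (1 / real (Suc n) ^ (2 * s) - 1 / a ^ (2 * s)))"
    proof -
      \<comment> \<open>The factor \<open>real (Suc n) ^ 0\<close> presents the second series as the
        case \<open>r = 0\<close> of \<open>summable_recip_square_minus\<close>.\<close>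
      have "summable (\<lambda>n. 1 / (real (Suc n) ^ (2 * s) * (real (Suc n) ^ 2 - a ^ 2))
          - 1 / (real (Suc n) ^ 0 * (real (Suc n) ^ 2 - a ^ 2)) * (1 / a ^ (2 * s)))"
        by (intro summable_diff summable_mult2 summable_recip_square_minus)
      moreover have "1 / (x * d) - 1 / (y ^ 0 * d) * z = 1 / d * (1 / x - z)" for x y z d :: real
        by (simp add: algebra_simps)
      ultimately show ?thesis by (simp only:)
    qed
    have "(\<lambda>n. (1 / (real (Suc n) ^ 2 - a ^ 2) * (1 / real (Suc n) ^ (2 * s) - 1 / a ^ (2 * s))
        - 1 / real (Suc n) ^ (2 * s + 2)) / a ^ 2) sums ((Y s - zeta (2 * s + 2)) / a ^ 2)"
      unfolding Y_def by (intro sums_divide sums_diff summable_sums summ sums_zeta) simp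
    moreover have "(1 / (real (Suc n) ^ 2 - a ^ 2) * (1 / real (Suc n) ^ (2 * s) - 1 / a ^ (2 * s))
        - 1 / real (Suc n) ^ (2 * s + 2)) / a ^ 2 =
        1 / (real (Suc n) ^ 2 - a ^ 2) * (1 / real (Suc n) ^ (2 * Suc s) - 1 / a ^ (2 * Suc s))" for n
    proof -
      have "(1 / (x ^ 2 - a ^ 2) * (1 / u - 1 / v) - 1 / (u * x ^ 2)) / a ^ 2 =
          1 / (x ^ 2 - a ^ 2) * (1 / (u * x ^ 2) - 1 / (v * a ^ 2))"
        if "x ^ 2 - a ^ 2 \<noteq> 0" "x \<noteq> 0" "u \<noteq> 0" "v \<noteq> 0" for u v x :: real
        using that a0 by (simp add: divide_simps; simp add: algebra_simps)
      moreover have "2 * Suc s = 2 * s + 2" by simp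
      ultimately show ?thesis using D[of n] a0 by (simp only: power_add; simp)
    qed
    ultimately show ?thesis unfolding Y_def[of "Suc s"] by (simp only: sums_unique[symmetric])
  qed

  \<comment> \<open>Old summands gain a factor \<open>1 / a ^ 2\<close>; the new row
    \<open>n = Suc s\<close> carries exactly \<open>a ^ 2\<close> in its denominator.\<close>
  have P: "P (Suc s) = (P s + p) / a ^ 2"
  proof -
    have "(\<Sum>n=1..s. \<Sum>k=1..n. real ((2 * m+2 * k-2) choose (2 * k-2))
          * (zeta (2 * m+2 * k-1) * zeta (2 * n-2 * k+2) / a ^ (2 * Suc s-2 * n+2))) = P s / a ^ 2"
      unfolding P_def sum_divide_distrib
    proof (intro sum.cong refl)
      \<comment> \<open>The range of \<open>n\<close> keeps the truncated subtraction exact, so that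
        the exponent really grows by 2.\<close>
      fix n k assume "n \<in> {1..s}"
      hence "2 * Suc s - 2 * n + 2 = (2 * s - 2 * n + 2) + 2" by auto
      from power_drop_two[OF this]
      show "real ((2 * m+2 * k-2) choose (2 * k-2)) * (zeta (2 * m+2 * k-1) * zeta (2 * n-2 * k+2) / a ^ (2 * Suc s-2 * n+2)) =
        real ((2 * m+2 * k-2) choose (2 * k-2)) * (zeta (2 * m+2 * k-1) * zeta (2 * n-2 * k+2) / a ^ (2 * s-2 * n+2)) / a ^ 2"
        by (simp only: times_divide_eq_right)
    qed
    moreover have "(\<Sum>k=1..Suc s. real ((2 * m+2 * k-2) choose (2 * k-2))
          * (zeta (2 * m+2 * k-1) * zeta (2 * Suc s-2 * k+2) / a ^ (2 * Suc s-2 * Suc s+2))) = p / a ^ 2"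
      unfolding p_def sum_divide_distrib by (intro sum.cong) (auto simp: power2_eq_square)
    ultimately show ?thesis
      unfolding P_def[of "Suc s"] by (simp only: sum.cl_ivl_Suc; simp add: add_divide_distrib)
  qed

  have Q: "Q (Suc s) = (Q s + q) / a ^ 2"
  proof -
    have "(\<Sum>k=2..s+1. real ((2 * m+2 * k-2) choose (2 * k-2)) * (zeta (2 * m+2 * k-1) / a ^ (2 * Suc s+4-2 * k))) = Q s / a ^ 2"
      unfolding Q_def sum_divide_distrib
    proof (intro sum.cong refl)
      fix k assume "k \<in> {2..s+1}"
      hence "2 * Suc s + 4 - 2 * k = (2 * s + 4 - 2 * k) + 2" by auto
      from power_drop_two[OF this]
      show "real ((2 * m+2 * k-2) choose (2 * k-2)) * (zeta (2 * m+2 * k-1) / a ^ (2 * Suc s+4-2 * k)) =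
        real ((2 * m+2 * k-2) choose (2 * k-2)) * (zeta (2 * m+2 * k-1) / a ^ (2 * s+4-2 * k)) / a ^ 2"
        by (simp only: times_divide_eq_right)
    qed
    thus ?thesis unfolding Q_def[of "Suc s"] q_def
      by (simp add: add_divide_distrib numeral_3_eq_3)
  qed

  have Q': "Q' (Suc s) = (Q' s + q') / a ^ 2"
  proof -
    have "(\<Sum>j=1..s. zeta (2 * m+2 * j+1) / a ^ (2 * Suc s+2-2 * j) * real ((2 * m+2 * j) choose (2 * j-1))) = Q' s / a ^ 2"
      unfolding Q'_def sum_divide_distrib
    proof (intro sum.cong refl)
      fix j assume "j \<in> {1..s}"
      hence "2 * Suc s + 2 - 2 * j = (2 * s + 2 - 2 * j) + 2" by auto
      from power_drop_two[OF this]
      show "zeta (2 * m+2 * j+1) / a ^ (2 * Suc s+2-2 * j) * real ((2 * m+2 * j) choose (2 * j-1)) =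
        zeta (2 * m+2 * j+1) / a ^ (2 * s+2-2 * j) * real ((2 * m+2 * j) choose (2 * j-1)) / a ^ 2"
        by (simp only: times_divide_eq_left)
    qed
    thus ?thesis unfolding Q'_def[of "Suc s"] q'_def
      by (simp add: add_divide_distrib numeral_3_eq_3)
  qed

  have P': "P' (Suc s) = (P' s + p') / a ^ 2"
  proof -
    have "(\<Sum>j=1..Suc s. zeta (2 * k) / a ^ (2 * Suc s+2-2 * j)
          * real ((2 * m-2 * k+2 * j) choose (2 * j-1)) * zeta (2 * m+2 * j-2 * k+1)) =
        ((\<Sum>j=1..s. zeta (2 * k) / a ^ (2 * s+2-2 * j)
          * real ((2 * m-2 * k+2 * j) choose (2 * j-1)) * zeta (2 * m+2 * j-2 * k+1))
        + zeta (2 * k) * real ((2 * m - 2 * k + 2 * Suc s) choose (2 * s + 1)) * zeta (2 * m + 2 * Suc s - 2 * k + 1)) / a ^ 2" for k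
    proof -
      have "(\<Sum>j=1..s. zeta (2 * k) / a ^ (2 * Suc s+2-2 * j)
          * real ((2 * m-2 * k+2 * j) choose (2 * j-1)) * zeta (2 * m+2 * j-2 * k+1)) =
        (\<Sum>j=1..s. zeta (2 * k) / a ^ (2 * s+2-2 * j)
          * real ((2 * m-2 * k+2 * j) choose (2 * j-1)) * zeta (2 * m+2 * j-2 * k+1)) / a ^ 2"
        unfolding sum_divide_distrib
      proof (intro sum.cong refl)
        fix j assume "j \<in> {1..s}"
        hence "2 * Suc s + 2 - 2 * j = (2 * s + 2 - 2 * j) + 2" by auto
        from power_drop_two[OF this]
        show "zeta (2 * k) / a ^ (2 * Suc s+2-2 * j) * real ((2 * m-2 * k+2 * j) choose (2 * j-1)) * zeta (2 * m+2 * j-2 * k+1) =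
          zeta (2 * k) / a ^ (2 * s+2-2 * j) * real ((2 * m-2 * k+2 * j) choose (2 * j-1)) * zeta (2 * m+2 * j-2 * k+1) / a ^ 2"
          by (simp only: times_divide_eq_left)
      qed
      moreover have "2 * Suc s + 2 - 2 * Suc s = 2" "2 * Suc s - 1 = 2 * s + 1" by simp_all
      ultimately show ?thesis by (simp only: sum.cl_ivl_Suc; simp add: add_divide_distrib)
    qed
    thus ?thesis unfolding P'_def p'_def
      by (simp only: sum_divide_distrib[symmetric] sum.distrib)
  qed

  have "(\<lambda>n. (gen_harmonic (Suc n) (2 * m+1) / (real (Suc n) ^ (2 * s) * (real (Suc n) ^ 2 - a ^ 2))
      - gen_harmonic (Suc n) (2 * m + 1) / real (Suc n) ^ (2 * s + 2)) / a ^ 2) sums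
      ((1/2 * X s + P s + zeta (2 * m+1) * Y s - 1/2 * Q s + pi * cot (pi * a) / (4 * a ^ (2 * s+1)) * U
        - 1/2 * Q' s + P' s - 1 / (2 * a ^ (2 * s+1)) * V
       - (1/2 * zeta (2 * m + 2 * s + 3) + zeta (2 * m + 1) * zeta (2 * s + 2) - p + 1/2 * q + 1/2 * q' - p')) / a ^ 2)"
    by (intro sums_divide sums_diff[OF IH euler])
  moreover have "(gen_harmonic (Suc n) (2 * m+1) / (real (Suc n) ^ (2 * s) * (real (Suc n) ^ 2 - a ^ 2))
      - gen_harmonic (Suc n) (2 * m + 1) / real (Suc n) ^ (2 * s + 2)) / a ^ 2 =
      gen_harmonic (Suc n) (2 * m+1) / (real (Suc n) ^ (2 * Suc s) * (real (Suc n) ^ 2 - a ^ 2))" for n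
  proof -
    have "(h / (u * (x ^ 2 - a ^ 2)) - h / (u * x ^ 2)) / a ^ 2 = h / (u * x ^ 2 * (x ^ 2 - a ^ 2))"
      if "x ^ 2 - a ^ 2 \<noteq> 0" "x \<noteq> 0" "u \<noteq> 0" for h u x :: real
      using that a0 by (simp add: divide_simps; simp add: algebra_simps)
    moreover have "2 * Suc s = 2 * s + 2" by simp
    ultimately show ?thesis using D[of n] by (simp only: power_add; simp)
  qed
  \<comment> \<open>\<open>U\<close> and \<open>V\<close> do not depend on \<open>s\<close>; only
    their prefactors change. The product \<open>zeta (2 * m + 1) * zeta (2 * s + 2)\<close> is
    absorbed by the recurrence of \<open>Y\<close>.\<close>
  moreover have "(1/2 * X s + P s + zeta (2 * m+1) * Y s - 1/2 * Q s + pi * cot (pi * a) / (4 * a ^ (2 * s+1)) * U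
        - 1/2 * Q' s + P' s - 1 / (2 * a ^ (2 * s+1)) * V
       - (1/2 * zeta (2 * m + 2 * s + 3) + zeta (2 * m + 1) * zeta (2 * s + 2) - p + 1/2 * q + 1/2 * q' - p')) / a ^ 2 =
      1/2 * X (Suc s) + P (Suc s) + zeta (2 * m+1) * Y (Suc s) - 1/2 * Q (Suc s)
        + pi * cot (pi * a) / (4 * a ^ (2 * Suc s+1)) * U
        - 1/2 * Q' (Suc s) + P' (Suc s) - 1 / (2 * a ^ (2 * Suc s+1)) * V"
  proof -
    have "pi * cot (pi * a) / (4 * a ^ (2 * Suc s+1)) * U = pi * cot (pi * a) / (4 * a ^ (2 * s+1)) * U / a ^ 2"
      "1 / (2 * a ^ (2 * Suc s+1)) * V = 1 / (2 * a ^ (2 * s+1)) * V / a ^ 2"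
      by (simp_all add: power2_eq_square)
    thus ?thesis unfolding X P Y Q Q' P'
      by (simp only: add_divide_distrib diff_divide_distrib distrib_left right_diff_distrib
          times_divide_eq_right)
  qed
  ultimately show ?case
    by (simp only: X_def P_def Y_def Q_def Q'_def P'_def U_def V_def)
qed

end
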